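(* Every locally finite Polish action $\mathbf{T}:G\curvearrowright(X,\mathcal{B},\mu)$ of a Polish group $G$ is a base action of a spatial Poissonian action; that is, there are a standard probability space $(\Omega,\mathcal{F},\mathbb{P})$, a generative Poisson point process $\mathcal{P}$ on it with base space $(X,\mathcal{B},\mu)$, and a spatial probability preserving action $\mathbf{S}$ of $G$ on $(\Omega,\mathcal{F},\mathbb{P})$ that is a Poissonian action with respect to $\mathcal{P}$ and has $\mathbf{T}$ as a base action.
   Context: A standard measure space $(X,\mathcal{B},\mu)$ is a standard Borel space with a non-atomic Borel measure that is either a probability measure (then it is called a standard probability space) or an infinite $\sigma$-finite measure. $\mathcal{B}_\mu=\{A\in\mathcal{B}:\mu(A)<\infty\}$. A Borel action of a Polish group $G$ on a standard Borel space $(X,\mathcal{B})$ is a jointly Borel map $G\times X\to X$, $(g,x)\mapsto T_g(x)$, with $T_e=\mathrm{Id}_X$ and $T_g\circ T_h=T_{gh}$ for all $g,h\in G$. It is $\tau$-Polish, for a Polish topology $\tau$ on $X$ generating $\mathcal{B}$, if this map is jointly continuous. A (measure preserving) spatial action on a standard measure space $(X,\mathcal{B},\mu)$ is a Borel action with $\mu\circ T_g^{-1}=\mu$ for every $g\in G$. A locally finite Polish action is a measure preserving action $\mathbf{T}:G\curvearrowright(X,\mathcal{B},\mu)$ on a standard measure space with a Polish topology $\tau$ on $X$ (generating $\mathcal{B}$) for which, simultaneously, $\mathbf{T}$ is a $\tau$-Polish action and $\mu$ is $\tau$-locally finite (every point of $X$ has a $\tau$-neighborhood of finite measure). For $0\le\alpha\le\infty$,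 $\mathrm{Poiss}(\alpha)$ is the Poisson distribution with mean $\alpha$; for $\alpha\in\{0,\infty\}$ it is the distribution of the constant $\alpha$. A Poisson point process with base space $(X,\mathcal{B},\mu)$ is a collection $\mathcal{P}=\{P_A:A\in\mathcal{B}\}$ of random variables on a standard probability space $(\Omega,\mathcal{F},\mathbb{P})$ such that $P_A$ has distribution $\mathrm{Poiss}(\mu(A))$ for every $A\in\mathcal{B}$, and $P_{A\cup B}=P_A+P_B$ $\mathbb{P}$-a.s. whenever $A,B\in\mathcal{B}$ are disjoint. It is generative if its members generate $\mathcal{F}$ modulo $\mathbb{P}$. Put $H(\mathcal{P})=\overline{\mathrm{span}}\{P_A:A\in\mathcal{B}_\mu\}\subset L^2_{\mathbb{R}}(\Omega,\mathcal{F},\mathbb{P})$. For $\mathcal{P}$ generative, a probability preserving action $\mathbf{S}$ of $G$ on $(\Omega,\mathcal{F},\mathbb{P})$ is a Poissonian action with respect to $\mathcal{P}$ if its Koopman representation $U_gf=f\circ S_g^{-1}$ preserves $H(\mathcal{P})$; it is a spatial Poissonian action if it is in addition a spatial action. An action $\mathbf{T}:G\curvearrowright(X,\mathcal{B},\mu)$ is a base action for $\mathbf{S}$ if $P_A\circ S_g=P_{T_g^{-1}(A)}$ $\mathbb{P}$-a.e. for every $g\in G$ and $A\in\mathcal{B}$.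
   Formalization: If μ is a probability measure, the event P_X = 0 is an atom of Ω of mass 1/e, so Ω cannot be non-atomic; in that case Ω is only claimed to be a standard Borel space with a probability measure, and non-atomicity is claimed when μ(X) is infinite. *)

theory Defs
  imports "HOL-Probability.Probability" "HOL-Algebra.Group"
begin

subsection \<open>Polish topologies, Polish groups and standard measure spaces\<close>

definition Polish_topology :: "'a topology \<Rightarrow> bool" where
  "Polish_topology \<tau> \<longleftrightarrow> completely_metrizable_space \<tau> \<and> second_countable \<tau>"

definition borel_of :: "'a topology \<Rightarrow> 'a measure" where
  "borel_of \<tau> = sigma (topspace \<tau>) {U. openin \<tau> U}"

definition generating_Polish_topology :: "'a measure \<Rightarrow> 'a topology \<Rightarrow> bool" where
  "generating_Polish_topology M \<tau> \<longleftrightarrow>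
     Polish_topology \<tau> \<and> topspace \<tau> = space M \<and> sets M = sets (borel_of \<tau>)"

definition Polish_group :: "('g, 'b) monoid_scheme \<Rightarrow> 'g topology \<Rightarrow> bool" where
  "Polish_group G \<tau>\<^sub>G \<longleftrightarrow>
     group G \<and> topspace \<tau>\<^sub>G = carrier G \<and> Polish_topology \<tau>\<^sub>G \<and>
     continuous_map (prod_topology \<tau>\<^sub>G \<tau>\<^sub>G) \<tau>\<^sub>G (\<lambda>(g, h). g \<otimes>\<^bsub>G\<^esub> h) \<and>
     continuous_map \<tau>\<^sub>G \<tau>\<^sub>G (\<lambda>g. inv\<^bsub>G\<^esub> g)"

definition standard_Borel_space :: "'a measure \<Rightarrow> bool" where
  "standard_Borel_space M \<longleftrightarrow> (\<exists>\<tau>. generating_Polish_topology M \<tau>)"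

definition is_atom :: "'a measure \<Rightarrow> 'a set \<Rightarrow> bool" where
  "is_atom M A \<longleftrightarrow> A \<in> sets M \<and> 0 < emeasure M A \<and>
     (\<forall>B\<in>sets M. B \<subseteq> A \<longrightarrow> emeasure M B = 0 \<or> emeasure M (A - B) = 0)"

definition nonatomic :: "'a measure \<Rightarrow> bool" where
  "nonatomic M \<longleftrightarrow> (\<nexists>A. is_atom M A)"

definition standard_measure_space :: "'a measure \<Rightarrow> bool" where
  "standard_measure_space M \<longleftrightarrow>
     standard_Borel_space M \<and> nonatomic M \<and>
     (prob_space M \<or> emeasure M (space M) = \<infinity> \<and> sigma_finite_measure M)"

definition standard_probability_space :: "'a measure \<Rightarrow> bool" where
  "standard_probability_space M \<longleftrightarrow> standard_measure_space M \<and> prob_space M"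

subsection \<open>Actions\<close>

definition Borel_action ::
  "('g, 'b) monoid_scheme \<Rightarrow> 'g topology \<Rightarrow> 'a measure \<Rightarrow> ('g \<Rightarrow> 'a \<Rightarrow> 'a) \<Rightarrow> bool" where
  "Borel_action G \<tau>\<^sub>G M T \<longleftrightarrow>
     (\<lambda>(g, x). T g x) \<in> measurable (borel_of \<tau>\<^sub>G \<Otimes>\<^sub>M M) M \<and>
     (\<forall>x\<in>space M. T \<one>\<^bsub>G\<^esub> x = x) \<and>
     (\<forall>g\<in>carrier G. \<forall>h\<in>carrier G. \<forall>x\<in>space M. T g (T h x) = T (g \<otimes>\<^bsub>G\<^esub> h) x)"

text \<open>The requirements on the underlying space (standard Borel, non-atomic, ...) are stated
  separately.\<close>

definition spatial_action ::
  "('g, 'b) monoid_scheme \<Rightarrow> 'g topology \<Rightarrow> 'a measure \<Rightarrow> ('g \<Rightarrow> 'a \<Rightarrow> 'a) \<Rightarrow> bool" where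
  "spatial_action G \<tau>\<^sub>G M T \<longleftrightarrow>
     Borel_action G \<tau>\<^sub>G M T \<and>
     (\<forall>g\<in>carrier G. \<forall>A\<in>sets M. emeasure M (T g -` A \<inter> space M) = emeasure M A)"

definition locally_finite_measure_on :: "'a topology \<Rightarrow> 'a measure \<Rightarrow> bool" where
  "locally_finite_measure_on \<tau> M \<longleftrightarrow>
     (\<forall>x\<in>topspace \<tau>. \<exists>U. openin \<tau> U \<and> x \<in> U \<and> emeasure M U < \<infinity>)"

definition locally_finite_Polish_action ::
  "('g, 'b) monoid_scheme \<Rightarrow> 'g topology \<Rightarrow> 'a measure \<Rightarrow> ('g \<Rightarrow> 'a \<Rightarrow> 'a) \<Rightarrow> bool" where
  "locally_finite_Polish_action G \<tau>\<^sub>G M T \<longleftrightarrow>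
     standard_measure_space M \<and> spatial_action G \<tau>\<^sub>G M T \<and>
     (\<exists>\<tau>. generating_Polish_topology M \<tau> \<and>
          continuous_map (prod_topology \<tau>\<^sub>G \<tau>) \<tau> (\<lambda>(g, x). T g x) \<and>
          locally_finite_measure_on \<tau> M)"

subsection \<open>Poisson point processes\<close>

text \<open>The library's \<open>poisson_pmf\<close> is only meaningful for a positive rate, so the two degenerate
  means are given explicitly.\<close>

definition Poiss :: "ennreal \<Rightarrow> enat measure" where
  "Poiss \<alpha> =
     (if \<alpha> = 0 then return (count_space UNIV) 0
      else if \<alpha> = \<infinity> then return (count_space UNIV) \<infinity>
      else distr (measure_pmf (poisson_pmf (enn2real \<alpha>))) (count_space UNIV) enat)"

text \<open>Base space \<open>M\<close>, probability space \<open>\<Omega>\<close>.\<close>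

definition Poisson_point_process ::
  "'a measure \<Rightarrow> 'w measure \<Rightarrow> ('a set \<Rightarrow> 'w \<Rightarrow> enat) \<Rightarrow> bool" where
  "Poisson_point_process M \<Omega> P \<longleftrightarrow>
     (\<forall>A\<in>sets M. P A \<in> measurable \<Omega> (count_space UNIV) \<and>
        distr \<Omega> (count_space UNIV) (P A) = Poiss (emeasure M A)) \<and>
     (\<forall>A\<in>sets M. \<forall>B\<in>sets M. A \<inter> B = {} \<longrightarrow>
        (AE \<omega> in \<Omega>. P (A \<union> B) \<omega> = P A \<omega> + P B \<omega>))"

definition generative :: "'a measure \<Rightarrow> 'w measure \<Rightarrow> ('a set \<Rightarrow> 'w \<Rightarrow> enat) \<Rightarrow> bool" where
  "generative M \<Omega> P \<longleftrightarrow>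
     (\<forall>F\<in>sets \<Omega>.
        \<exists>E\<in>sigma_sets (space \<Omega>) {P A -` K \<inter> space \<Omega> | A K. A \<in> sets M}.
          emeasure \<Omega> ((F - E) \<union> (E - F)) = 0)"

text \<open>Real-valued version of \<open>P A\<close>; the value at \<open>\<infinity>\<close>, attained only on a null set when
  \<open>A\<close> has finite measure, becomes \<open>0\<close>.\<close>

definition real_count :: "('a set \<Rightarrow> 'w \<Rightarrow> enat) \<Rightarrow> 'a set \<Rightarrow> 'w \<Rightarrow> real" where
  "real_count P A \<omega> = enn2real (ennreal_of_enat (P A \<omega>))"

text \<open>Elements of the real space \<open>L\<^sup>2\<close> are represented by functions instead of classes modulo
  a.e. equality; \<open>Poisson_H\<close> is closed under a.e. equality. For a Poisson point process the members
  of \<open>Poisson_span\<close> are square integrable, so the integral in \<open>Poisson_H\<close>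
  never takes the default value \<open>0\<close> of a non-integrable function.\<close>

definition square_integrable :: "'w measure \<Rightarrow> ('w \<Rightarrow> real) \<Rightarrow> bool" where
  "square_integrable \<Omega> f \<longleftrightarrow>
     f \<in> borel_measurable \<Omega> \<and> integrable \<Omega> (\<lambda>\<omega>. (f \<omega>)\<^sup>2)"

definition Poisson_span ::
  "'a measure \<Rightarrow> ('a set \<Rightarrow> 'w \<Rightarrow> enat) \<Rightarrow> ('w \<Rightarrow> real) set" where
  "Poisson_span M P =
     {(\<lambda>\<omega>. \<Sum>A\<in>\<A>. c A * real_count P A \<omega>) | \<A> c.
        finite \<A> \<and> \<A> \<subseteq> {A \<in> sets M. emeasure M A < \<infinity>}}"

definition Poisson_H ::
  "'a measure \<Rightarrow> 'w measure \<Rightarrow> ('a set \<Rightarrow> 'w \<Rightarrow> enat) \<Rightarrow> ('w \<Rightarrow> real) set" where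
  "Poisson_H M \<Omega> P =
     {f. square_integrable \<Omega> f \<and>
         (\<forall>\<epsilon>>0. \<exists>h\<in>Poisson_span M P. sqrt (\<integral>\<omega>. (f \<omega> - h \<omega>)\<^sup>2 \<partial>\<Omega>) < \<epsilon>)}"

definition Koopman ::
  "('g, 'b) monoid_scheme \<Rightarrow> ('g \<Rightarrow> 'w \<Rightarrow> 'w) \<Rightarrow> 'g \<Rightarrow> ('w \<Rightarrow> real) \<Rightarrow> ('w \<Rightarrow> real)" where
  "Koopman G S g f = f \<circ> S (inv\<^bsub>G\<^esub> g)"

definition spatial_Poissonian_action ::
  "('g, 'b) monoid_scheme \<Rightarrow> 'g topology \<Rightarrow> 'a measure \<Rightarrow> 'w measure \<Rightarrow>
   ('a set \<Rightarrow> 'w \<Rightarrow> enat) \<Rightarrow> ('g \<Rightarrow> 'w \<Rightarrow> 'w) \<Rightarrow> bool" where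
  "spatial_Poissonian_action G \<tau>\<^sub>G M \<Omega> P S \<longleftrightarrow>
     spatial_action G \<tau>\<^sub>G \<Omega> S \<and>
     (\<forall>g\<in>carrier G. Koopman G S g ` Poisson_H M \<Omega> P \<subseteq> Poisson_H M \<Omega> P)"

definition base_action ::
  "('g, 'b) monoid_scheme \<Rightarrow> 'a measure \<Rightarrow> ('g \<Rightarrow> 'a \<Rightarrow> 'a) \<Rightarrow> 'w measure \<Rightarrow>
   ('a set \<Rightarrow> 'w \<Rightarrow> enat) \<Rightarrow> ('g \<Rightarrow> 'w \<Rightarrow> 'w) \<Rightarrow> bool" where
  "base_action G M T \<Omega> P S \<longleftrightarrow>
     (\<forall>g\<in>carrier G. \<forall>A\<in>sets M.
        AE \<omega> in \<Omega>. P A (S g \<omega>) = P (T g -` A \<inter> space M) \<omega>)"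

text \<open>A generative Poisson point process over a base of finite measure lives on a space that has
  an atom, namely the event that there are no points at all. Hence non-atomicity of the
  probability space can only be asked for when the base has infinite measure.

  A sample space of type \<open>real measure\<close>, with arbitrary space and sigma-algebra, is
  fully general: a standard Borel space has at most the cardinality of the continuum, and all the
  notions above are invariant under transport along bijections.\<close>

lemma finite_base_atom:
  assumes Om: "prob_space \<Omega>" and P: "Poisson_point_process M \<Omega> P" and gen: "generative M \<Omega> P"
    and fin: "emeasure M (space M) < \<infinity>"
  shows "is_atom \<Omega> (P (space M) -` {0} \<inter> space \<Omega>)"
proof -
  interpret prob_space \<Omega> by fact
  define E where "E = P (space M) -` {0} \<inter> space \<Omega>"
  have meas: "P A \<in> measurable \<Omega> (count_space UNIV)" if "A \<in> sets M" for A
    using P that by (auto simp: Poisson_point_process_def)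
  have E: "E \<in> sets \<Omega>"
    unfolding E_def by (rule measurable_sets[OF meas]) auto
  have "emeasure \<Omega> E = emeasure (distr \<Omega> (count_space UNIV) (P (space M))) {0}"
    unfolding E_def by (subst emeasure_distr[OF meas]) auto
  also have "\<dots> = emeasure (Poiss (emeasure M (space M))) {0}"
    using P by (simp add: Poisson_point_process_def)
  also have "\<dots> > 0"
  proof (cases "emeasure M (space M) = 0")
    case True
    then show ?thesis by (simp add: Poiss_def)
  next
    case False
    then have r: "0 < enn2real (emeasure M (space M))"
      using fin by (simp add: enn2real_positive_iff zero_less_iff_neq_zero)
    have v: "enat -` {0} = {0}" by (auto simp: enat_0_iff)
    show ?thesis using False fin r
      by (simp add: Poiss_def emeasure_distr v emeasure_pmf_single)
  qed
  finally have pos: "0 < emeasure \<Omega> E" .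
  have zero: "AE \<omega> in \<Omega>. \<omega> \<in> E \<longrightarrow> P A \<omega> = 0" if A: "A \<in> sets M" for A
  proof -
    have "AE \<omega> in \<Omega>. P (A \<union> (space M - A)) \<omega> = P A \<omega> + P (space M - A) \<omega>"
      using P A sets.compl_sets[OF A] Diff_disjoint[of A "space M"]
      unfolding Poisson_point_process_def by blast
    moreover have "A \<union> (space M - A) = space M"
      using sets.sets_into_space[OF A] by auto
    ultimately show ?thesis by (auto simp: E_def)
  qed
  define Q where "Q F \<longleftrightarrow> (AE \<omega> in \<Omega>. \<omega> \<in> E \<longrightarrow> \<omega> \<in> F) \<or> (AE \<omega> in \<Omega>. \<omega> \<in> E \<longrightarrow> \<omega> \<notin> F)" for F
  have Q: "Q F" if "F \<in> sigma_sets (space \<Omega>) {P A -` K \<inter> space \<Omega> | A K. A \<in> sets M}" for F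
    using that
  proof induction
    case (Basic F)
    then obtain A K where F: "F = P A -` K \<inter> space \<Omega>" and A: "A \<in> sets M" by auto
    show ?case
    proof (cases "0 \<in> K")
      case True
      have "AE \<omega> in \<Omega>. \<omega> \<in> E \<longrightarrow> \<omega> \<in> F"
        using zero[OF A] by eventually_elim (use True in \<open>auto simp: F E_def\<close>)
      then show ?thesis by (simp add: Q_def)
    next
      case False
      have "AE \<omega> in \<Omega>. \<omega> \<in> E \<longrightarrow> \<omega> \<notin> F"
        using zero[OF A] by eventually_elim (use False in \<open>auto simp: F E_def\<close>)
      then show ?thesis by (simp add: Q_def)
    qed
  next
    case Empty
    show ?case by (simp add: Q_def)
  next
    case (Compl F)
    from Compl.IH consider "AE \<omega> in \<Omega>. \<omega> \<in> E \<longrightarrow> \<omega> \<in> F" | "AE \<omega> in \<Omega>. \<omega> \<in> E \<longrightarrow> \<omega> \<notin> F"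
      by (auto simp: Q_def)
    then show ?case
    proof cases
      case 1
      then have "AE \<omega> in \<Omega>. \<omega> \<in> E \<longrightarrow> \<omega> \<notin> space \<Omega> - F" by eventually_elim auto
      then show ?thesis by (simp add: Q_def)
    next
      case 2
      then have "AE \<omega> in \<Omega>. \<omega> \<in> E \<longrightarrow> \<omega> \<in> space \<Omega> - F" by eventually_elim (auto simp: E_def)
      then show ?thesis by (simp add: Q_def)
    qed
  next
    case (Union F)
    show ?case
    proof (cases "\<exists>i. AE \<omega> in \<Omega>. \<omega> \<in> E \<longrightarrow> \<omega> \<in> F i")
      case True
      then obtain i where "AE \<omega> in \<Omega>. \<omega> \<in> E \<longrightarrow> \<omega> \<in> F i" by blast
      then have "AE \<omega> in \<Omega>. \<omega> \<in> E \<longrightarrow> \<omega> \<in> (\<Union>i. F i)" by eventually_elim auto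
      then show ?thesis by (simp add: Q_def)
    next
      case False
      then have "AE \<omega> in \<Omega>. \<omega> \<in> E \<longrightarrow> \<omega> \<notin> F i" for i
        using Union.IH[of i] by (auto simp: Q_def)
      then have "AE \<omega> in \<Omega>. \<forall>i. \<omega> \<in> E \<longrightarrow> \<omega> \<notin> F i" by (subst AE_all_countable) blast
      then have "AE \<omega> in \<Omega>. \<omega> \<in> E \<longrightarrow> \<omega> \<notin> (\<Union>i. F i)" by eventually_elim auto
      then show ?thesis by (simp add: Q_def)
    qed
  qed
  have "emeasure \<Omega> B = 0 \<or> emeasure \<Omega> (E - B) = 0" if B: "B \<in> sets \<Omega>" "B \<subseteq> E" for B
  proof -
    obtain F where F: "F \<in> sigma_sets (space \<Omega>) {P A -` K \<inter> space \<Omega> | A K. A \<in> sets M}"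
      and null: "emeasure \<Omega> ((B - F) \<union> (F - B)) = 0"
      using gen B by (auto simp: generative_def)
    have "F \<in> sets \<Omega>"
      using F by (rule set_mp[OF sets.sigma_sets_subset, rotated])
        (auto intro!: measurable_sets[OF meas])
    with B null have "(B - F) \<union> (F - B) \<in> null_sets \<Omega>" by auto
    then have eq: "AE \<omega> in \<Omega>. \<omega> \<notin> (B - F) \<union> (F - B)" by (rule AE_not_in)
    from Q[OF F] consider "AE \<omega> in \<Omega>. \<omega> \<in> E \<longrightarrow> \<omega> \<in> F" | "AE \<omega> in \<Omega>. \<omega> \<in> E \<longrightarrow> \<omega> \<notin> F"
      by (auto simp: Q_def)
    then show ?thesis
    proof cases
      case 1
      with eq have "AE \<omega> in \<Omega>. \<omega> \<notin> E - B" by eventually_elim auto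
      with E B have "E - B \<in> null_sets \<Omega>" by (subst AE_iff_null_sets) auto
      then show ?thesis by auto
    next
      case 2
      with eq have "AE \<omega> in \<Omega>. \<omega> \<notin> B" by eventually_elim (use B in auto)
      with B have "B \<in> null_sets \<Omega>" by (subst AE_iff_null_sets) auto
      then show ?thesis by auto
    qed
  qed
  with E pos show ?thesis by (auto simp: is_atom_def E_def)
qed

end

theory Submission
  imports Defs
begin

text \<open>
  The base action moves points by homeomorphisms for the given topology, so it acts on closed
  sets, and a Poisson configuration is a random closed set: the base measure is locally finite, hence
  almost surely the points accumulate nowhere. The locally finite configurations
  themselves are not a suitable sample space, because in a Polish space that is not locally compact
  they need not form a Borel set. The sample space used here consists of all closed sets with the
  Effros sigma-algebra, which is generated by the events that a given open set is met. It
  is standard Borel (\<open>standard_Borel_Effros\<close>), since the patterns of basic open sets met by closed sets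
  form a \<open>G\<^sub>\<delta>\<close> set, and the group acts on it everywhere, by images. Joint continuity of the base action
  makes this action jointly Borel (\<open>jointly_measurable_move\<close>).

  The law of a random closed set is determined by the probabilities of avoiding an open set
  (\<open>Effros_measure_eqI\<close>). For a Poisson configuration the probability of avoiding \<open>U\<close> is
  \<open>exp (- M U)\<close>. As the base action preserves \<open>M\<close>, the law of the configuration is invariant
  (\<open>distr_move\<close>).

  A Poisson configuration is produced by sampling. The base measure is a countable sum of
  multiples of probability measures; for each of them a Poisson number of independent points is
  drawn. Generating functions show that the number of points in any Borel set has the
  right Poisson distribution, the infinite mean included (\<open>distr_count_hits\<close>). Because the base measure has no
  atoms, the points are almost surely distinct, and the set of points carries the same counts as the sample
  (\<open>AE_configuration\<close>).

  Counting is additive, a moved configuration has in \<open>A\<close> as many points as the original one in the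
  preimage of \<open>A\<close>, and meeting an open set means having a nonzero count in it. These facts yield
  the point process, the base action and generativity. The Koopman operators preserve the closed span of the counts
  because they preserve its generators up to null sets.
\<close>

section \<open>Generating functions of extended natural numbers\<close>

text \<open>The value at \<open>\<infinity>\<close> is the limit of \<open>s ^ n\<close> for \<open>0 \<le> s < 1\<close>. With this convention the generating function
\<open>s \<mapsto> E (s ^ N)\<close> ignores the mass at \<open>\<infinity>\<close>, which can nevertheless be read off as the defect of
the total mass.\<close>

definition enat_pow :: "real \<Rightarrow> enat \<Rightarrow> real" where
  "enat_pow s N = (case N of enat n \<Rightarrow> s ^ n | \<infinity> \<Rightarrow> 0)"

lemma enat_pow_simps [simp]: "enat_pow s (enat n) = s ^ n" "enat_pow s \<infinity> = 0"
  by (simp_all add: enat_pow_def)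

lemma nn_integral_poisson_pow:
  assumes c: "0 < c" and a: "0 \<le> a"
  shows "(\<integral>\<^sup>+n. ennreal (a ^ n) \<partial>poisson_pmf c) = ennreal (exp (- c * (1 - a)))"
proof -
  have "(\<lambda>n. (c * a) ^ n /\<^sub>R fact n) sums exp (c * a)" by (rule exp_converges)
  then have "(\<lambda>n. exp (- c) * ((c * a) ^ n /\<^sub>R fact n)) sums (exp (- c) * exp (c * a))"
    by (rule sums_mult)
  then have sm: "(\<lambda>n. pmf (poisson_pmf c) n * a ^ n) sums exp (- c * (1 - a))"
    using c by (simp add: power_mult_distrib field_simps exp_diff exp_minus)
  have "(\<integral>\<^sup>+n. ennreal (a ^ n) \<partial>poisson_pmf c)
      = (\<integral>\<^sup>+n. ennreal (pmf (poisson_pmf c) n) * ennreal (a ^ n) \<partial>count_space UNIV)"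
    by (rule nn_integral_measure_pmf)
  also have "\<dots> = (\<Sum>n. ennreal (pmf (poisson_pmf c) n) * ennreal (a ^ n))"
    by (rule nn_integral_count_space_nat)
  also have "\<dots> = (\<Sum>n. ennreal (pmf (poisson_pmf c) n * a ^ n))"
    using a by (simp add: ennreal_mult)
  also have "\<dots> = ennreal (exp (- c * (1 - a)))"
    using sm a by (intro suminf_ennreal_eq) (use c in auto)
  finally show ?thesis .
qed

lemma space_Poiss [simp]: "space (Poiss \<alpha>) = UNIV" and sets_Poiss [simp]: "sets (Poiss \<alpha>) = UNIV"
  by (auto simp: Poiss_def)

lemma prob_space_Poiss: "prob_space (Poiss \<alpha>)"
  unfolding Poiss_def
  by (auto intro!: prob_space_return prob_space.prob_space_distr measure_pmf.prob_space_axioms)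

lemma pgf_Poiss:
  assumes s: "0 \<le> s" "s < 1"
  shows "(\<integral>\<^sup>+N. ennreal (enat_pow s N) \<partial>Poiss \<alpha>)
      = (if \<alpha> = \<infinity> then 0 else ennreal (exp (- enn2real \<alpha> * (1 - s))))"
proof -
  consider "\<alpha> = 0" | "\<alpha> = \<infinity>" | "\<alpha> \<noteq> 0" "\<alpha> \<noteq> \<infinity>" by blast
  then show ?thesis
  proof cases
    case 1
    then show ?thesis by (simp add: Poiss_def nn_integral_return zero_enat_def)
  next
    case 2
    then show ?thesis by (simp add: Poiss_def nn_integral_return)
  next
    case 3
    then have "0 < enn2real \<alpha>" by (simp add: enn2real_positive_iff zero_less_iff_neq_zero less_top)
    with 3 show ?thesis using s nn_integral_poisson_pow[of "enn2real \<alpha>" s]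
      by (simp add: Poiss_def nn_integral_distr)
  qed
qed

text \<open>Only nonnegative arguments are available, since generating functions are integrals of nonnegative
functions. The coefficient of lowest order is the limit of the power series, divided by the lowest
power, as the argument decreases to 0.\<close>

lemma powser_zero_imp_coeff_zero:
  fixes d :: "nat \<Rightarrow> real"
  assumes sm: "\<And>s. 0 < s \<Longrightarrow> s < 1 \<Longrightarrow> (\<lambda>n. d n * s ^ n) sums 0"
  shows "d n = 0"
proof (induction n rule: less_induct)
  case (less m)
  have shift: "(\<lambda>n. d (n + m) * s ^ n) sums 0" if s: "0 < s" "s < 1" for s
  proof -
    have "(\<Sum>i<m. d i * s ^ i) = 0" using less.IH by simp
    then have "(\<lambda>n. d (n + m) * s ^ (n + m)) sums 0"
      using sums_split_initial_segment[OF sm[OF s], of m] by simp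
    from sums_mult[OF this, of "inverse (s ^ m)"] s show ?thesis
      by (simp add: power_add field_simps)
  qed
  have sb: "summable (\<lambda>n. d (n + m) * (1/2) ^ n)"
    using shift[of "1/2"] by (simp add: sums_iff)
  have "isCont (\<lambda>x. \<Sum>n. d (n + m) * x ^ n) 0"
    by (rule isCont_powser[OF sb]) simp
  then have "((\<lambda>x. \<Sum>n. d (n + m) * x ^ n) \<longlongrightarrow> (\<Sum>n. d (n + m) * 0 ^ n)) (at_right 0)"
    by (simp add: isCont_def filterlim_at_split)
  moreover have "\<forall>\<^sub>F x in at_right 0. (\<Sum>n. d (n + m) * x ^ n) = 0"
    using eventually_at_right_less[of "0::real"] eventually_at_right_real[of 0 "1::real", simplified]
    by eventually_elim (use shift in \<open>auto simp: sums_iff\<close>)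
  ultimately have "((\<lambda>x::real. 0) \<longlongrightarrow> (\<Sum>n. d (n + m) * 0 ^ n)) (at_right (0::real))"
    by (rule Lim_transform_eventually)
  then have "(\<Sum>n. d (n + m) * 0 ^ n) = 0"
    by (simp add: tendsto_const_iff)
  then show ?case by (simp add: powser_zero)
qed

lemma pgf_sums:
  fixes A :: "enat measure"
  assumes pA: "prob_space A" and A: "sets A = UNIV" and s: "0 \<le> s" "s < 1"
  shows "(\<lambda>n. measure A {enat n} * s ^ n) sums enn2real (\<integral>\<^sup>+N. ennreal (enat_pow s N) \<partial>A)"
proof -
  interpret prob_space A by fact
  have meas [measurable_cong]: "sets A = sets (count_space UNIV)" using A by simp
  have pow_eq: "ennreal (enat_pow s N) = (\<Sum>n. ennreal (s ^ n) * indicator {enat n} N)" for N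
  proof (cases N)
    case (enat m)
    have "(\<Sum>n. ennreal (s ^ n) * indicator {enat n} N) = (\<Sum>n\<in>{m}. ennreal (s ^ n) * indicator {enat n} N)"
      by (rule suminf_finite) (auto simp: enat)
    then show ?thesis by (simp add: enat)
  qed simp
  have "(\<integral>\<^sup>+N. ennreal (enat_pow s N) \<partial>A) = (\<Sum>n. \<integral>\<^sup>+N. ennreal (s ^ n) * indicator {enat n} N \<partial>A)"
    unfolding pow_eq by (rule nn_integral_suminf) (simp add: measurable_cong_sets[OF meas])
  also have "\<dots> = (\<Sum>n. ennreal (measure A {enat n} * s ^ n))"
    using s by (simp add: nn_integral_cmult_indicator A emeasure_eq_measure ennreal_mult mult.commute)
  finally have eq: "(\<integral>\<^sup>+N. ennreal (enat_pow s N) \<partial>A) = (\<Sum>n. ennreal (measure A {enat n} * s ^ n))" .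
  have "summable (\<lambda>n. measure A {enat n} * s ^ n)"
  proof (rule summable_comparison_test'[of "\<lambda>n. s ^ n" 0])
    show "summable (\<lambda>n. s ^ n)" using s by (simp add: summable_geometric)
  qed (use s in \<open>auto simp: mult_left_le_one_le\<close>)
  then show ?thesis unfolding eq using s
    by (subst suminf_ennreal2) (auto simp: suminf_nonneg summable_sums)
qed

text \<open>The generating function gives the masses of the finite numbers, and the total mass being 1 then
forces the mass of \<open>\<infinity>\<close>. Infinite means are therefore not a separate case when counts are shown
to be Poisson distributed.\<close>

lemma pgf_determines_law:
  fixes A B :: "enat measure"
  assumes A: "prob_space A" "sets A = UNIV" and B: "prob_space B" "sets B = UNIV"
    and eq: "\<And>s. 0 \<le> s \<Longrightarrow> s < 1 \<Longrightarrow>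
      (\<integral>\<^sup>+N. ennreal (enat_pow s N) \<partial>A) = (\<integral>\<^sup>+N. ennreal (enat_pow s N) \<partial>B)"
  shows "A = B"
proof -
  interpret A: prob_space A by fact
  interpret B: prob_space B by fact
  have "measure A {enat n} - measure B {enat n} = 0" for n
  proof (rule powser_zero_imp_coeff_zero)
    fix s :: real assume s: "0 < s" "s < 1"
    then show "(\<lambda>n. (measure A {enat n} - measure B {enat n}) * s ^ n) sums 0"
      using sums_diff[OF pgf_sums[OF A, of s] pgf_sums[OF B, of s]] eq[of s]
      by (simp add: left_diff_distrib)
  qed
  then have fin: "emeasure A {enat n} = emeasure B {enat n}" for n
    by (simp add: A.emeasure_eq_measure B.emeasure_eq_measure)
  have spA: "space A = UNIV" "space B = UNIV"
    using sets.top[of A] sets.top[of B] A(2) B(2) sets_eq_imp_space_eq[of A "count_space UNIV"]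
      sets_eq_imp_space_eq[of B "count_space UNIV"] by auto
  have rng: "emeasure A (range enat) = emeasure B (range enat)"
  proof -
    have "emeasure A (range enat) = (\<integral>\<^sup>+x. emeasure A {x} \<partial>count_space (range enat))"
      by (rule emeasure_countable_singleton) (auto simp: A)
    also have "\<dots> = (\<integral>\<^sup>+x. emeasure B {x} \<partial>count_space (range enat))"
      by (rule nn_integral_cong) (auto simp: fin)
    also have "\<dots> = emeasure B (range enat)"
      by (rule emeasure_countable_singleton[symmetric]) (auto simp: B)
    finally show ?thesis .
  qed
  have inf: "{\<infinity>} = UNIV - range enat" by (auto simp: image_iff)
  have "emeasure A {\<infinity>} = emeasure B {\<infinity>}"
    unfolding inf using emeasure_compl[of "range enat" A] emeasure_compl[of "range enat" B] rng
      A.emeasure_space_1 B.emeasure_space_1 A(2) B(2) by (simp add: spA)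
  with fin have "emeasure A {N} = emeasure B {N}" for N by (cases N) auto
  then show ?thesis
    using A(2) B(2) by (intro measure_eqI_countable[of _ UNIV]) auto
qed

section \<open>Counting with values in the extended natural numbers\<close>

definition ecard :: "'a set \<Rightarrow> enat" where
  "ecard S = (if finite S then enat (card S) else \<infinity>)"

lemma ennreal_of_enat_ecard: "ennreal_of_enat (ecard S) = emeasure (count_space UNIV) S"
  by (simp add: ecard_def)

lemma ecard_Un_disjoint: "A \<inter> B = {} \<Longrightarrow> ecard (A \<union> B) = ecard A + ecard B"
  by (auto simp: ecard_def card_Un_disjoint)

lemma ecard_eq_0_iff [simp]: "ecard S = 0 \<longleftrightarrow> S = {}"
  by (auto simp: ecard_def zero_enat_def)

lemma ecard_image: "inj_on f S \<Longrightarrow> ecard (f ` S) = ecard S"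
  by (simp add: ecard_def card_image finite_image_iff)

text \<open>This passes from the points found in finitely many pieces of the base space to all points, whether
or not there are infinitely many.\<close>

lemma enat_pow_ecard_LIMSEQ:
  assumes s: "0 \<le> s" "s < 1" and fin: "\<And>m. finite (S m)" and inc: "incseq S"
  shows "(\<lambda>m. s ^ card (S m)) \<longlonglongrightarrow> enat_pow s (ecard (\<Union>m. S m))"
proof (cases "finite (\<Union>m. S m)")
  case True
  have "\<exists>m. x \<in> S m" if "x \<in> (\<Union>m. S m)" for x using that by auto
  then obtain f where f: "\<And>x. x \<in> (\<Union>m. S m) \<Longrightarrow> x \<in> S (f x)" by metis
  define m0 where "m0 = Max (insert 0 (f ` (\<Union>m. S m)))"
  have eq: "S m = (\<Union>m. S m)" if "m0 \<le> m" for m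
  proof -
    have "f x \<le> m" if "x \<in> (\<Union>m. S m)" for x
      using that True \<open>m0 \<le> m\<close> unfolding m0_def by (subst (asm) Max_le_iff) auto
    then have "x \<in> S m" if "x \<in> (\<Union>m. S m)" for x
      using f[OF that] incseqD[OF inc] that by blast
    then show ?thesis by blast
  qed
  have "\<forall>\<^sub>F m in sequentially. s ^ card (S m) = enat_pow s (ecard (\<Union>m. S m))"
    using eventually_ge_at_top[of m0] by eventually_elim (simp only: eq ecard_def True enat_pow_simps if_True)
  then show ?thesis by (rule tendsto_eventually)
next
  case False
  have "filterlim (\<lambda>m. card (S m)) at_top sequentially"
    unfolding filterlim_at_top
  proof
    fix k
    obtain F where F: "F \<subseteq> (\<Union>m. S m)" "finite F" "card F = k"
      using False infinite_arbitrarily_large by blast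
    then obtain f where f: "\<And>x. x \<in> F \<Longrightarrow> x \<in> S (f x)" by (metis UN_E subsetD)
    have "k \<le> card (S m)" if "Max (insert 0 (f ` F)) \<le> m" for m
    proof -
      have "f x \<le> m" if "x \<in> F" for x
        using that F(2) \<open>Max (insert 0 (f ` F)) \<le> m\<close> by (subst (asm) Max_le_iff) auto
      then have "F \<subseteq> S m" using f incseqD[OF inc] by blast
      then show ?thesis using F(3) fin card_mono by blast
    qed
    then show "\<forall>\<^sub>F m in sequentially. k \<le> card (S m)"
      by (rule eventually_sequentiallyI)
  qed
  moreover have "(\<lambda>n. s ^ n) \<longlonglongrightarrow> 0" using s by (intro LIMSEQ_power_zero) simp
  ultimately have "(\<lambda>m. s ^ card (S m)) \<longlonglongrightarrow> 0" by (rule filterlim_compose[rotated])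
  then show ?thesis using False by (simp add: ecard_def)
qed

lemma measurable_enat_ge:
  fixes f :: "'w \<Rightarrow> enat"
  assumes "\<And>k. {w \<in> space W. enat k \<le> f w} \<in> sets W"
  shows "f \<in> measurable W (count_space UNIV)"
proof -
  have fin: "f -` {enat k} \<inter> space W \<in> sets W" for k
  proof -
    have "f -` {enat k} \<inter> space W
        = {w \<in> space W. enat k \<le> f w} - {w \<in> space W. enat (Suc k) \<le> f w}"
      by (auto simp: Suc_ile_eq)
    then show ?thesis using assms by (simp only: sets.Diff)
  qed
  have "f -` {\<infinity>} \<inter> space W = space W - (\<Union>k. f -` {enat k} \<inter> space W)"
    by (auto simp: not_enat_eq) 
  then have "f -` {\<infinity>} \<inter> space W \<in> sets W"
    by (simp only:) (use fin in \<open>intro sets.Diff sets.top sets.countable_UN; auto\<close>)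
  with fin have "f -` {N} \<inter> space W \<in> sets W" for N by (cases N) auto
  then show ?thesis by (subst measurable_count_space_eq2_countable) auto
qed

lemma enat_le_ecard_iff: "enat k \<le> ecard S \<longleftrightarrow> (\<exists>F. finite F \<and> F \<subseteq> S \<and> card F = k)"
proof (cases "finite S")
  case True
  then show ?thesis
    using obtain_subset_with_card_n[of k S] by (auto simp: ecard_def intro: card_mono)
next
  case False
  then show ?thesis using infinite_arbitrarily_large[OF False, of k] by (auto simp: ecard_def)
qed

lemma measurable_ecard:
  fixes S :: "'w \<Rightarrow> 'i::countable set"
  assumes S: "\<And>i. {w \<in> space W. i \<in> S w} \<in> sets W"
  shows "(\<lambda>w. ecard (S w)) \<in> measurable W (count_space UNIV)"
proof (rule measurable_enat_ge)
  fix k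
  have "{w \<in> space W. enat k \<le> ecard (S w)}
      = (\<Union>F\<in>{F. finite F \<and> card F = k}. {w \<in> space W. \<forall>i\<in>F. i \<in> S w})"
    by (auto simp: enat_le_ecard_iff)
  also have "\<dots> \<in> sets W"
  proof (rule sets.countable_UN'')
    show "countable {F :: 'i set. finite F \<and> card F = k}"
      by (rule countable_subset[OF _ countable_Collect_finite]) auto
    show "{w \<in> space W. \<forall>i\<in>F. i \<in> S w} \<in> sets W" if "F \<in> {F. finite F \<and> card F = k}" for F
      using that S by (auto intro!: sets.sets_Collect_finite_All)
  qed
  finally show "{w \<in> space W. enat k \<le> ecard (S w)} \<in> sets W" .
qed

section \<open>Sampling a Poisson configuration\<close>

lemma nn_integral_PiM_prod:
  assumes P: "\<And>i. prob_space (Q i)" and J: "finite J"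
    and f: "\<And>j. j \<in> J \<Longrightarrow> f j \<in> borel_measurable (Q j)"
  shows "(\<integral>\<^sup>+x. (\<Prod>j\<in>J. f j (x j)) \<partial>PiM UNIV Q) = (\<Prod>j\<in>J. \<integral>\<^sup>+y. f j y \<partial>Q j)"
proof -
  interpret product_prob_space Q UNIV
    using P by (simp add: product_prob_space_def product_prob_space_axioms_def
        product_sigma_finite_def prob_space_imp_sigma_finite)
  have meas: "(\<lambda>x. \<Prod>j\<in>J. f j (x j)) \<in> borel_measurable (PiM J Q)"
    using f by measurable
  have "(\<integral>\<^sup>+x. (\<Prod>j\<in>J. f j (x j)) \<partial>PiM UNIV Q)
      = (\<integral>\<^sup>+x. (\<Prod>j\<in>J. f j (restrict x J j)) \<partial>PiM UNIV Q)"
    by (auto intro!: nn_integral_cong prod.cong)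
  also have "\<dots> = (\<integral>\<^sup>+x. (\<Prod>j\<in>J. f j (x j)) \<partial>distr (PiM UNIV Q) (PiM J Q) (\<lambda>x. restrict x J))"
    using meas by (subst nn_integral_distr) auto
  also have "\<dots> = (\<Prod>j\<in>J. \<integral>\<^sup>+y. f j y \<partial>Q j)"
    using J f by (simp add: distr_PiM_restrict_finite product_nn_integral_prod)
  finally show ?thesis .
qed

text \<open>Two coordinates are independent, so by Fubini the probability that they agree is an average of
masses of single points. Together with the absence of atoms of the base measure this makes the
sampled configuration simple: it is a set, without multiplicities.\<close>

lemma AE_PiM_coordinates_distinct:
  assumes P: "\<And>i. prob_space (Q i)" and Q: "\<And>i. sets (Q i) = sets M"
    and diag: "{p \<in> space (M \<Otimes>\<^sub>M M). fst p = snd p} \<in> sets (M \<Otimes>\<^sub>M M)"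
    and null: "\<And>i x. x \<in> space M \<Longrightarrow> emeasure (Q i) {x} = 0"
    and ij: "i \<noteq> j"
  shows "AE x in PiM UNIV Q. x i \<noteq> x j"
proof -
  interpret product_prob_space Q UNIV
    using P by (simp add: product_prob_space_def product_prob_space_axioms_def
        product_sigma_finite_def prob_space_imp_sigma_finite)
  define D where "D = {p \<in> space (M \<Otimes>\<^sub>M M). fst p = snd p}"
  have sQ: "sets (Q i \<Otimes>\<^sub>M Q j) = sets (M \<Otimes>\<^sub>M M)"
    by (intro sets_pair_measure_cong Q)
  have spQ: "space (Q i) = space M" for i by (rule sets_eq_imp_space_eq[OF Q])
  have D: "D \<in> sets (Q i \<Otimes>\<^sub>M Q j)" using diag unfolding sQ D_def .
  have ind: "indicator D \<in> borel_measurable (Q i \<Otimes>\<^sub>M Q j)" using D by simp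
  have Dx: "Pair x -` D = (if x \<in> space M then {x} else {})" for x
    by (auto simp: D_def space_pair_measure)
  have "(\<integral>\<^sup>+x. indicator D (x i, x j) \<partial>PiM UNIV Q)
      = (\<integral>\<^sup>+x. indicator D (restrict x {i, j} i, restrict x {i, j} j) \<partial>PiM UNIV Q)"
    by simp
  also have "\<dots> = (\<integral>\<^sup>+x. indicator D (x i, x j)
      \<partial>distr (PiM UNIV Q) (PiM {i, j} Q) (\<lambda>x. restrict x {i, j}))"
    by (subst nn_integral_distr) (auto intro!: measurable_compose[OF _ ind])
  also have "\<dots> = (\<integral>\<^sup>+x. indicator D (x i, x j) \<partial>PiM {i, j} Q)"
    by (simp add: distr_PiM_restrict_finite)
  also have "\<dots> = (\<integral>\<^sup>+z. indicator D z \<partial>(Q i \<Otimes>\<^sub>M Q j))"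
    using product_nn_integral_pair[of "\<lambda>y z. indicator D (y, z)" i j] ind ij by simp
  also have "\<dots> = emeasure (Q i \<Otimes>\<^sub>M Q j) D"
    using D by simp
  also have "\<dots> = (\<integral>\<^sup>+x. emeasure (Q j) (Pair x -` D) \<partial>Q i)"
    using D by (rule M.emeasure_pair_measure_alt)
  also have "\<dots> = 0"
  proof -
    have "emeasure (Q j) (Pair x -` D) = 0" for x
      by (cases "x \<in> space M") (simp_all add: Dx null)
    then show ?thesis by simp
  qed
  finally have "(\<integral>\<^sup>+x. indicator D (x i, x j) \<partial>PiM UNIV Q) = 0" .
  then have "AE x in PiM UNIV Q. indicator D (x i, x j) = (0::ennreal)"
    by (subst (asm) nn_integral_0_iff_AE) (auto intro!: measurable_compose[OF _ ind])
  then show ?thesis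
  proof (rule AE_mp, intro AE_I2 impI)
    fix x assume x: "x \<in> space (PiM UNIV Q)" and 0: "indicator D (x i, x j) = (0::ennreal)"
    from x have "x i \<in> space M" "x j \<in> space M" by (auto simp: space_PiM spQ)
    with 0 show "x i \<noteq> x j" by (auto simp: D_def space_pair_measure indicator_def split: if_splits)
  qed
qed

text \<open>The base measure is written as a sum of multiples \<open>c n\<close> of probability measures \<open>\<nu> n\<close>. The
superposition, over all \<open>n\<close>, of a Poisson distributed number (with mean \<open>c n\<close>) of independent points with
law \<open>\<nu> n\<close> is a Poisson process.\<close>

locale poisson_sampling =
  fixes M :: "'a measure" and c :: "nat \<Rightarrow> real" and \<nu> :: "nat \<Rightarrow> 'a measure"
  assumes c_nonneg: "0 \<le> c n"
    and prob_\<nu>: "prob_space (\<nu> n)"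
    and sets_\<nu>: "sets (\<nu> n) = sets M"
    and emeasure_M: "A \<in> sets M \<Longrightarrow> emeasure M A = (\<Sum>n. ennreal (c n) * emeasure (\<nu> n) A)"
begin

text \<open>The point mass at 0 stands in for the Poisson distribution of mean 0, which is outside the
range of \<open>poisson_pmf\<close>.\<close>

definition number_law :: "nat \<Rightarrow> nat measure" where
  "number_law n = measure_pmf (if c n = 0 then return_pmf 0 else poisson_pmf (c n))"

text \<open>A sample consists of the numbers of points of each kind and of an infinite supply of candidate points:
the candidate with index \<open>(n, k)\<close> has law \<open>\<nu> n\<close> and is used if \<open>k\<close> is less than the \<open>n\<close>-th number. All
candidates are drawn, so that the space is a product.\<close>

definition sample_space :: "((nat \<Rightarrow> nat) \<times> (nat \<times> nat \<Rightarrow> 'a)) measure" where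
  "sample_space = PiM UNIV number_law \<Otimes>\<^sub>M PiM UNIV (\<lambda>j. \<nu> (fst j))"

definition sampled :: "(nat \<Rightarrow> nat) \<times> (nat \<times> nat \<Rightarrow> 'a) \<Rightarrow> (nat \<times> nat) set" where
  "sampled w = {j. snd j < fst w (fst j)}"

definition hits :: "'a set \<Rightarrow> (nat \<Rightarrow> nat) \<times> (nat \<times> nat \<Rightarrow> 'a) \<Rightarrow> (nat \<times> nat) set" where
  "hits A w = {j \<in> sampled w. snd w j \<in> A}"

lemma prob_number_law: "prob_space (number_law n)"
  unfolding number_law_def by (rule measure_pmf.prob_space_axioms)

lemma sets_number_law [simp, measurable_cong]: "sets (number_law n) = sets (count_space UNIV)"
  by (simp add: number_law_def)

lemma space_number_law [simp]: "space (number_law n) = UNIV"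
  by (simp add: number_law_def)

lemma prob_numbers: "prob_space (PiM UNIV number_law)"
  by (rule prob_space_PiM) (rule prob_number_law)

lemma prob_points: "prob_space (PiM UNIV (\<lambda>j. \<nu> (fst j)))"
  by (rule prob_space_PiM) (rule prob_\<nu>)

lemma prob_sample_space: "prob_space sample_space"
  unfolding sample_space_def by (rule prob_space_pair) (rule prob_numbers prob_points)+

lemma space_\<nu>: "space (\<nu> n) = space M"
  by (rule sets_eq_imp_space_eq[OF sets_\<nu>])

lemma point_in_space: "w \<in> space sample_space \<Longrightarrow> snd w j \<in> space M"
  by (auto simp: sample_space_def space_pair_measure space_PiM space_\<nu>)

lemma measurable_number [measurable]:
  "(\<lambda>w. fst w n) \<in> measurable sample_space (count_space UNIV)"
proof -
  have "(\<lambda>w. fst w n) \<in> measurable sample_space (number_law n)"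
    unfolding sample_space_def by measurable
  then show ?thesis by (simp add: measurable_cong_sets[OF refl sets_number_law])
qed

lemma measurable_point [measurable]: "(\<lambda>w. snd w j) \<in> measurable sample_space M"
proof -
  have "(\<lambda>w. snd w j) \<in> measurable sample_space (\<nu> (fst j))"
    unfolding sample_space_def by measurable
  then show ?thesis by (simp add: measurable_cong_sets[OF refl sets_\<nu>])
qed

lemma sets_hits:
  assumes [measurable]: "A \<in> sets M"
  shows "{w \<in> space sample_space. j \<in> hits A w} \<in> sets sample_space"
  unfolding hits_def sampled_def mem_Collect_eq by measurable

lemma measurable_count_hits:
  "A \<in> sets M \<Longrightarrow> (\<lambda>w. ecard (hits A w)) \<in> measurable sample_space (count_space UNIV)"
  by (intro measurable_ecard sets_hits)

lemma nn_integral_number_pow: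
  assumes "0 \<le> a"
  shows "(\<integral>\<^sup>+k. ennreal a ^ k \<partial>number_law n) = ennreal (exp (- c n * (1 - a)))"
proof (cases "c n = 0")
  case True
  then show ?thesis by (simp add: number_law_def nn_integral_return_pmf)
next
  case False
  then show ?thesis using c_nonneg[of n] assms nn_integral_poisson_pow[of "c n" a]
    by (simp add: number_law_def ennreal_power)
qed

text \<open>Given the numbers, each candidate used contributes an independent factor, of mean
\<open>a n = 1 - (1 - s) * \<nu> n A\<close>. What is left is a product of Poisson generating functions at \<open>a n\<close>,
whose exponents \<open>- c n * (1 - a n)\<close> add up.\<close>

lemma pgf_hits_upto:
  assumes A [measurable]: "A \<in> sets M" and s: "0 \<le> s" "s < 1"
  shows "(\<integral>\<^sup>+w. ennreal (s ^ card {j \<in> hits A w. fst j < m}) \<partial>sample_space)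
    = ennreal (exp (- (1 - s) * (\<Sum>n<m. c n * measure (\<nu> n) A)))"
proof -
  interpret X: prob_space "PiM UNIV (\<lambda>j. \<nu> (fst j))" by (rule prob_points)
  define h where "h x = (if x \<in> A then ennreal s else 1)" for x
  have h [measurable]: "h \<in> borel_measurable M" unfolding h_def by measurable
  have h\<nu> [measurable]: "h \<in> borel_measurable (\<nu> n)" for n
    using h by (simp add: measurable_cong_sets[OF sets_\<nu> refl])
  define J where "J N = Sigma {..<m} (\<lambda>n. {..<N n})" for N :: "nat \<Rightarrow> nat"
  have Jfin: "finite (J N)" for N by (simp add: J_def)
  define a where "a n = 1 - (1 - s) * measure (\<nu> n) A" for n
  have a0: "0 \<le> a n" for n
  proof -
    interpret prob_space "\<nu> n" by (rule prob_\<nu>)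
    have "(1 - s) * measure (\<nu> n) A \<le> 1 * 1" by (intro mult_mono) (use s in auto)
    then show ?thesis by (simp add: a_def)
  qed
  have h_int: "(\<integral>\<^sup>+x. h x \<partial>\<nu> n) = ennreal (a n)" for n
  proof -
    interpret prob_space "\<nu> n" by (rule prob_\<nu>)
    have A': "A \<in> sets (\<nu> n)" by (simp add: sets_\<nu> A)
    have "(\<integral>\<^sup>+x. h x \<partial>\<nu> n) = (\<integral>\<^sup>+x. ennreal s * indicator A x + indicator (space (\<nu> n) - A) x \<partial>\<nu> n)"
      by (rule nn_integral_cong) (auto simp: h_def)
    also have "\<dots> = ennreal s * emeasure (\<nu> n) A + emeasure (\<nu> n) (space (\<nu> n) - A)"
      using A' by (subst nn_integral_add) (auto simp: nn_integral_cmult_indicator)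
    also have "\<dots> = ennreal (s * measure (\<nu> n) A + (1 - measure (\<nu> n) A))"
      using s A' by (simp add: emeasure_eq_measure prob_compl ennreal_mult)
    finally show ?thesis by (simp add: a_def algebra_simps)
  qed
  have card_eq: "ennreal (s ^ card {j \<in> hits A w. fst j < m}) = (\<Prod>j\<in>J (fst w). h (snd w j))" for w
  proof -
    have "{j \<in> hits A w. fst j < m} = {j \<in> J (fst w). snd w j \<in> A}"
      by (auto simp: hits_def sampled_def J_def)
    then show ?thesis using s Jfin[of "fst w"]
      by (simp add: h_def prod.If_cases ennreal_power Int_def)
  qed
  have prod_eq: "(\<Prod>j\<in>J (fst w). h (snd w j)) = (\<Prod>n<m. \<Prod>k<fst w n. h (snd w (n, k)))" for w
    unfolding J_def by (subst prod.Sigma) auto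
  have meas: "(\<lambda>w. \<Prod>j\<in>J (fst w). h (snd w j)) \<in> borel_measurable sample_space"
    unfolding prod_eq
  proof (intro borel_measurable_prod_ennreal)
    fix n
    show "(\<lambda>w. \<Prod>k<fst w n. h (snd w (n, k))) \<in> borel_measurable sample_space"
      by (rule measurable_compose_countable[where g="\<lambda>w. fst w n" and f="\<lambda>i w. \<Prod>k<i. h (snd w (n, k))"])
         measurable
  qed
  have inner: "(\<integral>\<^sup>+x. (\<Prod>j\<in>J N. h (x j)) \<partial>PiM UNIV (\<lambda>j. \<nu> (fst j))) = (\<Prod>n<m. ennreal (a n) ^ N n)" for N
  proof -
    have "(\<integral>\<^sup>+x. (\<Prod>j\<in>J N. h (x j)) \<partial>PiM UNIV (\<lambda>j. \<nu> (fst j))) = (\<Prod>j\<in>J N. \<integral>\<^sup>+y. h y \<partial>\<nu> (fst j))"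
      by (rule nn_integral_PiM_prod) (use prob_\<nu> Jfin in auto)
    also have "\<dots> = (\<Prod>n<m. \<Prod>k<N n. ennreal (a n))"
      unfolding J_def h_int by (subst prod.Sigma) (auto simp: case_prod_beta)
    finally show ?thesis by simp
  qed
  have "(\<integral>\<^sup>+w. ennreal (s ^ card {j \<in> hits A w. fst j < m}) \<partial>sample_space)
      = (\<integral>\<^sup>+N. \<integral>\<^sup>+x. (\<Prod>j\<in>J N. h (x j)) \<partial>PiM UNIV (\<lambda>j. \<nu> (fst j)) \<partial>PiM UNIV number_law)"
    unfolding card_eq using meas unfolding sample_space_def
    by (subst X.nn_integral_fst[symmetric]) auto
  also have "\<dots> = (\<integral>\<^sup>+N. (\<Prod>n<m. ennreal (a n) ^ N n) \<partial>PiM UNIV number_law)"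
    unfolding inner ..
  also have "\<dots> = (\<Prod>n<m. \<integral>\<^sup>+k. ennreal (a n) ^ k \<partial>number_law n)"
    by (rule nn_integral_PiM_prod) (use prob_number_law in auto)
  also have "\<dots> = (\<Prod>n<m. ennreal (exp (- c n * (1 - a n))))"
    by (simp only: nn_integral_number_pow[OF a0])
  also have "\<dots> = ennreal (exp (\<Sum>n<m. - c n * (1 - a n)))"
    by (simp add: prod_ennreal exp_sum)
  also have "(\<Sum>n<m. - c n * (1 - a n)) = - (1 - s) * (\<Sum>n<m. c n * measure (\<nu> n) A)"
    by (simp add: a_def sum_distrib_left algebra_simps)
  finally show ?thesis .
qed

text \<open>As the number of kinds taken into account grows, the exponents tend to \<open>- (1 - s) * M A\<close>, also if this is
\<open>- \<infinity>\<close>. The limit of the generating functions is thus that of the Poisson distribution with mean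
\<open>M A\<close>.\<close>

theorem distr_count_hits:
  assumes A: "A \<in> sets M"
  shows "distr sample_space (count_space UNIV) (\<lambda>w. ecard (hits A w)) = Poiss (emeasure M A)"
proof (rule pgf_determines_law)
  interpret prob_space sample_space by (rule prob_sample_space)
  note meas = measurable_count_hits[OF A]
  show "prob_space (distr sample_space (count_space UNIV) (\<lambda>w. ecard (hits A w)))"
    by (rule prob_space_distr[OF meas])
  show "prob_space (Poiss (emeasure M A))" by (rule prob_space_Poiss)
  fix s :: real assume s: "0 \<le> s" "s < 1"
  define r where "r m = (\<Sum>n<m. c n * measure (\<nu> n) A)" for m
  have r: "(\<lambda>m. ennreal (r m)) \<longlonglongrightarrow> emeasure M A"
  proof -
    have "ennreal (r m) = (\<Sum>n<m. ennreal (c n) * emeasure (\<nu> n) A)" for m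
    proof -
      have "ennreal (c n) * emeasure (\<nu> n) A = ennreal (c n * measure (\<nu> n) A)" for n
        using c_nonneg[of n] finite_measure.emeasure_eq_measure[OF prob_space.finite_measure[OF prob_\<nu>], of n A]
        by (simp add: ennreal_mult)
      then show ?thesis using c_nonneg by (simp add: r_def sum_ennreal)
    qed
    then show ?thesis using A by (simp add: emeasure_M summable_LIMSEQ)
  qed
  have Un: "(\<Union>m. {j \<in> hits A w. fst j < m}) = hits A w" for w by auto
  have fin: "finite {j \<in> hits A w. fst j < m}" for w m
    by (rule finite_subset[of _ "Sigma {..<m} (\<lambda>n. {..<fst w n})"]) (auto simp: hits_def sampled_def)
  have lim: "(\<lambda>m. s ^ card {j \<in> hits A w. fst j < m}) \<longlonglongrightarrow> enat_pow s (ecard (hits A w))" for w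
    using enat_pow_ecard_LIMSEQ[OF s, of "\<lambda>m. {j \<in> hits A w. fst j < m}"] fin
    unfolding Un by (simp add: incseq_def Collect_mono_iff)
  have mcard: "(\<lambda>w. ennreal (s ^ card {j \<in> hits A w. fst j < m})) \<in> borel_measurable sample_space" for m
  proof -
    have "(\<lambda>w. ecard {j \<in> hits A w. fst j < m}) \<in> measurable sample_space (count_space UNIV)"
    proof (rule measurable_ecard)
      fix i
      have "{w \<in> space sample_space. i \<in> {j \<in> hits A w. fst j < m}}
         = (if fst i < m then {w \<in> space sample_space. i \<in> hits A w} else {})" by auto
      then show "{w \<in> space sample_space. i \<in> {j \<in> hits A w. fst j < m}} \<in> sets sample_space"
        using sets_hits[OF A, of i] by auto
    qed
    then have "(\<lambda>w. ennreal (enat_pow s (ecard {j \<in> hits A w. fst j < m}))) \<in> borel_measurable sample_space"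
      by (rule measurable_compose) simp
    then show ?thesis by (simp add: ecard_def fin)
  qed
  have "(\<lambda>m. \<integral>\<^sup>+w. ennreal (s ^ card {j \<in> hits A w. fst j < m}) \<partial>sample_space)
      \<longlonglongrightarrow> (\<integral>\<^sup>+w. ennreal (enat_pow s (ecard (hits A w))) \<partial>sample_space)"
  proof (rule nn_integral_dominated_convergence[where w="\<lambda>_. 1"])
    show "(\<lambda>w. ennreal (enat_pow s (ecard (hits A w)))) \<in> borel_measurable sample_space"
      by (rule measurable_compose[OF meas]) simp
    show "AE w in sample_space. ennreal (s ^ card {j \<in> hits A w. fst j < m}) \<le> 1" for m
      using s by (intro AE_I2) (simp add: power_le_one)
    show "AE w in sample_space. (\<lambda>m. ennreal (s ^ card {j \<in> hits A w. fst j < m}))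
        \<longlonglongrightarrow> ennreal (enat_pow s (ecard (hits A w)))"
      by (intro AE_I2 tendsto_ennrealI lim)
  qed (auto simp: mcard emeasure_space_1)
  then have L1: "(\<lambda>m. ennreal (exp (- (1 - s) * r m)))
      \<longlonglongrightarrow> (\<integral>\<^sup>+w. ennreal (enat_pow s (ecard (hits A w))) \<partial>sample_space)"
    by (simp only: pgf_hits_upto[OF A s] r_def)
  have L2: "(\<lambda>m. ennreal (exp (- (1 - s) * r m))) \<longlonglongrightarrow> (\<integral>\<^sup>+N. ennreal (enat_pow s N) \<partial>Poiss (emeasure M A))"
  proof (cases "emeasure M A = \<infinity>")
    case True
    then have "filterlim r at_top sequentially" using r by (simp add: ennreal_tendsto_top_eq_at_top)
    then have "filterlim (\<lambda>m. (1 - s) * r m) at_top sequentially"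
      using s by (intro filterlim_tendsto_pos_mult_at_top[OF tendsto_const]) auto
    then have "filterlim (\<lambda>m. - ((1 - s) * r m)) at_bot sequentially"
      by (simp add: filterlim_uminus_at_bot)
    then have "(\<lambda>m. exp (- ((1 - s) * r m))) \<longlonglongrightarrow> 0"
      by (rule filterlim_compose[OF exp_at_bot])
    then have "(\<lambda>m. exp (- (1 - s) * r m)) \<longlonglongrightarrow> 0" by (simp only: mult_minus_left)
    then have "(\<lambda>m. ennreal (exp (- (1 - s) * r m))) \<longlonglongrightarrow> ennreal 0" by (rule tendsto_ennrealI)
    then show ?thesis by (simp only: pgf_Poiss[OF s] True simp_thms if_True ennreal_0)
  next
    case False
    have r0: "0 \<le> r m" for m unfolding r_def by (intro sum_nonneg) (simp add: c_nonneg)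
    have "(\<lambda>m. ennreal (r m)) \<longlonglongrightarrow> ennreal (enn2real (emeasure M A))"
      using r False by (simp add: less_top)
    from tendsto_enn2real[OF this] have "r \<longlonglongrightarrow> enn2real (emeasure M A)"
      using r0 by simp
    then have "(\<lambda>m. ennreal (exp (- (1 - s) * r m)))
        \<longlonglongrightarrow> ennreal (exp (- (1 - s) * enn2real (emeasure M A)))"
      by (intro tendsto_intros)
    moreover have "- (1 - s) * enn2real (emeasure M A) = - enn2real (emeasure M A) * (1 - s)"
      by (simp add: algebra_simps)
    ultimately show ?thesis using False by (simp only: pgf_Poiss[OF s] if_False)
  qed
  show "(\<integral>\<^sup>+N. ennreal (enat_pow s N) \<partial>distr sample_space (count_space UNIV) (\<lambda>w. ecard (hits A w)))
      = (\<integral>\<^sup>+N. ennreal (enat_pow s N) \<partial>Poiss (emeasure M A))"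
    using LIMSEQ_unique[OF L1 L2] by (simp add: nn_integral_distr[OF meas])
qed auto

lemma AE_points_distinct:
  assumes diag: "{p \<in> space (M \<Otimes>\<^sub>M M). fst p = snd p} \<in> sets (M \<Otimes>\<^sub>M M)"
    and null: "\<And>n x. x \<in> space M \<Longrightarrow> emeasure (\<nu> n) {x} = 0"
  shows "AE w in sample_space. inj (snd w)"
proof -
  interpret X: prob_space "PiM UNIV (\<lambda>j. \<nu> (fst j))" by (rule prob_points)
  interpret N: prob_space "PiM UNIV number_law" by (rule prob_numbers)
  interpret pair_sigma_finite "PiM UNIV number_law" "PiM UNIV (\<lambda>j. \<nu> (fst j))" ..
  have "AE w in sample_space. snd w i \<noteq> snd w j" if ij: "i \<noteq> j" for i j
    unfolding sample_space_def
  proof (rule AE_pair_measure)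
    have "x k \<in> space M" if "(N, x) \<in> space sample_space" for N k and x :: "nat \<times> nat \<Rightarrow> 'a"
      using point_in_space[OF that, of k] by simp
    note pt = this[of _ _ i] this[of _ _ j]
    have "{w \<in> space sample_space. snd w i \<noteq> snd w j}
        = space sample_space - (\<lambda>w. (snd w i, snd w j)) -` {p \<in> space (M \<Otimes>\<^sub>M M). fst p = snd p} \<inter> space sample_space"
      by (auto simp: space_pair_measure pt)
    also have "\<dots> \<in> sets sample_space"
      by (intro sets.Diff measurable_sets[OF _ diag]) measurable
    finally show "{w \<in> space (PiM UNIV number_law \<Otimes>\<^sub>M PiM UNIV (\<lambda>j. \<nu> (fst j))). snd w i \<noteq> snd w j}
        \<in> sets (PiM UNIV number_law \<Otimes>\<^sub>M PiM UNIV (\<lambda>j. \<nu> (fst j)))"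
      by (simp add: sample_space_def)
    have "AE x in PiM UNIV (\<lambda>j. \<nu> (fst j)). x i \<noteq> x j"
      by (rule AE_PiM_coordinates_distinct[OF _ _ diag]) (use prob_\<nu> sets_\<nu> null ij in auto)
    then show "AE N in PiM UNIV number_law. AE x in PiM UNIV (\<lambda>j. \<nu> (fst j)). snd (N, x) i \<noteq> snd (N, x) j"
      by simp
  qed
  then have "AE w in sample_space. \<forall>i j. i \<noteq> j \<longrightarrow> snd w i \<noteq> snd w j"
    by (intro AE_all_countable[THEN iffD2] allI) (auto)
  then show ?thesis by eventually_elim (auto simp: inj_def)
qed

end

text \<open>Each \<open>\<nu> n\<close> is the base measure conditioned on a piece of a countable partition. A null piece
has weight 0 and cannot be conditioned on; any piece of positive measure can take its place.\<close>

lemma poisson_sampling_exists: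
  assumes "sigma_finite_measure M" and pos: "emeasure M (space M) \<noteq> 0"
    and null: "\<And>x. x \<in> space M \<Longrightarrow> emeasure M {x} = 0"
  obtains c \<nu> where "poisson_sampling M c \<nu>"
    and "\<And>n x. x \<in> space M \<Longrightarrow> emeasure (\<nu> n) {x} = 0"
proof -
  interpret sigma_finite_measure M by fact
  obtain X :: "nat \<Rightarrow> 'a set" where X: "range X \<subseteq> sets M" "(\<Union>i. X i) = space M"
    "\<And>i. emeasure M (X i) \<noteq> \<infinity>" "disjoint_family X"
    using sigma_finite_disjoint by blast
  have Xm: "X n \<in> sets M" for n using X(1) by auto
  obtain n0 where n0: "emeasure M (X n0) \<noteq> 0"
  proof (rule ccontr)
    assume "\<not> thesis"
    then have "emeasure M (X n) = 0" for n using that by blast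
    then have "emeasure M (\<Union>n. X n) = 0" using emeasure_UN_eq_0[of M X] X(1) by auto
    then show False using pos X(2) by simp
  qed
  define Y where "Y n = (if emeasure M (X n) = 0 then X n0 else X n)" for n
  have Y: "Y n \<in> sets M" "emeasure M (Y n) \<noteq> 0" "emeasure M (Y n) \<noteq> \<infinity>" for n
    using n0 Xm X(3) by (auto simp: Y_def)
  define c where "c n = measure M (X n)" for n
  define \<nu> where "\<nu> n = uniform_measure M (Y n)" for n
  show thesis
  proof (rule that[of c \<nu>])
    show "poisson_sampling M c \<nu>"
    proof (rule poisson_sampling.intro)
      show "0 \<le> c n" for n by (simp add: c_def)
      show "prob_space (\<nu> n)" for n unfolding \<nu>_def using Y by (intro prob_space_uniform_measure)
      show "sets (\<nu> n) = sets M" for n by (simp add: \<nu>_def)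
      fix A assume A: "A \<in> sets M"
      have "ennreal (c n) * emeasure (\<nu> n) A = emeasure M (X n \<inter> A)" for n
      proof (cases "emeasure M (X n) = 0")
        case True
        then have "emeasure M (X n \<inter> A) \<le> 0" using emeasure_mono[of "X n \<inter> A" "X n" M] Xm by auto
        then show ?thesis using True by (simp add: c_def measure_def)
      next
        case False
        have c: "ennreal (c n) = emeasure M (X n)"
          unfolding c_def using X(3)[of n] by (simp add: emeasure_eq_ennreal_measure)
        have "emeasure M (X n) * (emeasure M (X n \<inter> A) / emeasure M (X n)) = emeasure M (X n \<inter> A)"
          using False X(3)[of n] ennreal_mult_divide_eq[of "emeasure M (X n)" "emeasure M (X n \<inter> A)"]
          by (simp add: ennreal_times_divide mult.commute[of "emeasure M (X n)"])
        then show ?thesis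
          using False by (simp add: \<nu>_def c Y_def emeasure_uniform_measure[OF Xm A])
      qed
      then have "(\<Sum>n. ennreal (c n) * emeasure (\<nu> n) A) = (\<Sum>n. emeasure M (X n \<inter> A))" by simp
      also have "\<dots> = emeasure M (\<Union>n. X n \<inter> A)"
        using X(4) Xm A by (intro suminf_emeasure) (auto simp: disjoint_family_on_def)
      also have "(\<Union>n. X n \<inter> A) = A" using X(2) sets.sets_into_space[OF A] by auto
      finally show "emeasure M A = (\<Sum>n. ennreal (c n) * emeasure (\<nu> n) A)" by simp
    qed
    fix n x assume x: "x \<in> space M"
    show "emeasure (\<nu> n) {x} = 0"
    proof (cases "{x} \<in> sets M")
      case True
      then have "emeasure M (Y n \<inter> {x}) \<le> 0"
        using emeasure_mono[of "Y n \<inter> {x}" "{x}" M] null[OF x] by auto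
      then show ?thesis using True Y by (simp add: \<nu>_def)
    next
      case False
      then show ?thesis by (simp add: \<nu>_def emeasure_notin_sets)
    qed
  qed
qed

section \<open>The Borel space of closed sets\<close>

text \<open>Sample points have to be real numbers. Any bijection between sets of natural numbers and reals will do, because
topology and sigma-algebra are transported along it instead of being taken from the real line.\<close>

definition set_code :: "nat set \<Rightarrow> real" where
  "set_code = (SOME f. bij f)"

lemma bij_set_code: "bij set_code"
proof -
  have "\<exists>f :: nat set \<Rightarrow> real. bij f"
    using nat_sets_eqpoll_reals by (simp add: eqpoll_def)
  then show ?thesis unfolding set_code_def by (rule someI_ex)
qed

lemma inv_set_code [simp]: "inv_into UNIV set_code (set_code I) = I"
  by (rule inv_f_f) (rule bij_is_inj[OF bij_set_code])

lemma space_borel_of: "space (borel_of \<tau>) = topspace \<tau>"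
  unfolding borel_of_def by (rule space_measure_of) (use openin_subset in auto)

lemma sets_borel_of: "sets (borel_of \<tau>) = sigma_sets (topspace \<tau>) {U. openin \<tau> U}"
  unfolding borel_of_def by (rule sets_measure_of) (use openin_subset in auto)

lemma open_in_borel_of: "openin \<tau> U \<Longrightarrow> U \<in> sets (borel_of \<tau>)"
  unfolding sets_borel_of by (rule sigma_sets.Basic) simp

lemma second_countable_euclidean: "second_countable (euclidean :: 'b::second_countable_topology topology)"
proof -
  obtain B :: "'b set set" where B: "countable B" "topological_basis B"
    using ex_countable_basis by blast
  then show ?thesis unfolding second_countable_def
    by (metis open_openin topological_basis_open topological_basisE)
qed

lemma completely_metrizable_Baire: "completely_metrizable_space (euclidean :: (nat \<Rightarrow> nat) topology)"
proof -
  have disc: "discrete_topology UNIV = (euclidean :: nat topology)"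
    by (simp add: topology_eq Topological_Spaces.open_discrete)
  have "completely_metrizable_space (product_topology (\<lambda>_::nat. euclidean :: nat topology) UNIV)"
    unfolding completely_metrizable_space_product_topology
    by (simp add: completely_metrizable_space_discrete_topology flip: disc)
  then show ?thesis by (simp add: euclidean_product_topology)
qed

text \<open>A closed set is determined by the basic open sets that it meets. The pattern of these is what gets
encoded; the sigma-algebra generated by the events that a given basic open set is met is the Effros
sigma-algebra.\<close>

locale Polish_base =
  fixes \<tau> :: "'a topology" and V :: "nat \<Rightarrow> 'a set"
  assumes completely_metrizable: "completely_metrizable_space \<tau>"
    and open_V: "openin \<tau> (V i)"
    and base_V: "openin \<tau> U \<Longrightarrow> x \<in> U \<Longrightarrow> \<exists>i. x \<in> V i \<and> V i \<subseteq> U"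
begin

abbreviation closure_in :: "'a set \<Rightarrow> 'a set" where
  "closure_in \<equiv> Abstract_Topology.closure_of \<tau>"

definition closed_code :: "'a set \<Rightarrow> real" where
  "closed_code C = set_code {i. C \<inter> V i \<noteq> {}}"

definition decode :: "real \<Rightarrow> 'a set" where
  "decode \<omega> = {x \<in> topspace \<tau>. \<forall>i. x \<in> V i \<longrightarrow> i \<in> inv_into UNIV set_code \<omega>}"

definition closed_codes :: "real set" where
  "closed_codes = closed_code ` {C. closedin \<tau> C}"

definition Effros :: "real measure" where
  "Effros = sigma closed_codes (range (\<lambda>i. {\<omega> \<in> closed_codes. decode \<omega> \<inter> V i \<noteq> {}}))"

lemma open_UN_base: "openin \<tau> U \<Longrightarrow> U = (\<Union>i\<in>{i. V i \<subseteq> U}. V i)"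
  using base_V by blast

lemma closedin_decode: "closedin \<tau> (decode \<omega>)"
proof -
  have "topspace \<tau> - decode \<omega> = (\<Union>i\<in>{i. i \<notin> inv_into UNIV set_code \<omega>}. V i)"
    using openin_subset[OF open_V] unfolding decode_def by blast
  then have "openin \<tau> (topspace \<tau> - decode \<omega>)" using open_V by auto
  then show ?thesis by (auto simp: closedin_def decode_def)
qed

lemma decode_code:
  assumes C: "closedin \<tau> C"
  shows "decode (closed_code C) = C"
proof
  show "C \<subseteq> decode (closed_code C)"
    using closedin_subset[OF C] by (auto simp: decode_def closed_code_def)
  show "decode (closed_code C) \<subseteq> C"
  proof
    fix x assume x: "x \<in> decode (closed_code C)"
    show "x \<in> C"
    proof (rule ccontr)
      assume "x \<notin> C"
      then have "x \<in> topspace \<tau> - C" using x by (auto simp: decode_def)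
      moreover have "openin \<tau> (topspace \<tau> - C)" using C by (simp add: closedin_def)
      ultimately obtain i where "x \<in> V i" "V i \<subseteq> topspace \<tau> - C" using base_V by blast
      then show False using x by (auto simp: decode_def closed_code_def)
    qed
  qed
qed

lemma code_decode: "\<omega> \<in> closed_codes \<Longrightarrow> closed_code (decode \<omega>) = \<omega>"
  by (auto simp: closed_codes_def decode_code)

lemma code_in_closed_codes: "closedin \<tau> C \<Longrightarrow> closed_code C \<in> closed_codes"
  by (auto simp: closed_codes_def)

lemma mem_inv_set_code: "\<omega> \<in> closed_codes \<Longrightarrow> i \<in> inv_into UNIV set_code \<omega> \<longleftrightarrow> decode \<omega> \<inter> V i \<noteq> {}"
  by (subst code_decode[symmetric]) (simp_all add: closed_code_def)

lemma space_Effros [simp]: "space Effros = closed_codes"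
  unfolding Effros_def by (rule space_measure_of) auto

lemma sets_Effros: "sets Effros = sigma_sets closed_codes (range (\<lambda>i. {\<omega> \<in> closed_codes. decode \<omega> \<inter> V i \<noteq> {}}))"
  unfolding Effros_def by (rule sets_measure_of) auto

lemma base_hit_in_Effros: "{\<omega> \<in> closed_codes. decode \<omega> \<inter> V i \<noteq> {}} \<in> sets Effros"
  unfolding sets_Effros by (rule sigma_sets.Basic) auto

lemma open_hit_in_Effros:
  assumes U: "openin \<tau> U"
  shows "{\<omega> \<in> closed_codes. decode \<omega> \<inter> U \<noteq> {}} \<in> sets Effros"
proof -
  have "{\<omega> \<in> closed_codes. decode \<omega> \<inter> U \<noteq> {}}
      = (\<Union>i\<in>{i. V i \<subseteq> U}. {\<omega> \<in> closed_codes. decode \<omega> \<inter> V i \<noteq> {}})"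
    using open_UN_base[OF U] by blast
  then show ?thesis using base_hit_in_Effros by (auto intro!: sets.countable_UN')
qed

lemma measurable_into_Effros:
  assumes "\<And>w. w \<in> space W \<Longrightarrow> f w \<in> closed_codes"
    and "\<And>i. {w \<in> space W. decode (f w) \<inter> V i \<noteq> {}} \<in> sets W"
  shows "f \<in> measurable W Effros"
  unfolding Effros_def
proof (rule measurable_measure_of)
  show "f \<in> space W \<rightarrow> closed_codes" using assms(1) by auto
  fix y assume "y \<in> range (\<lambda>i. {\<omega> \<in> closed_codes. decode \<omega> \<inter> V i \<noteq> {}})"
  then obtain i where y: "y = {\<omega> \<in> closed_codes. decode \<omega> \<inter> V i \<noteq> {}}" by auto
  have "f -` y \<inter> space W = {w \<in> space W. decode (f w) \<inter> V i \<noteq> {}}"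
    using assms(1) by (auto simp: y)
  then show "f -` y \<inter> space W \<in> sets W" using assms(2) by simp
qed auto

definition hit_pattern :: "real \<Rightarrow> nat \<Rightarrow> nat" where
  "hit_pattern \<omega> i = of_bool (i \<in> inv_into UNIV set_code \<omega>)"

lemma hit_pattern_iff: "\<omega> \<in> closed_codes \<Longrightarrow> hit_pattern \<omega> i = of_bool (decode \<omega> \<inter> V i \<noteq> {})"
  by (simp add: hit_pattern_def mem_inv_set_code)

lemma hit_pattern_eq_1_iff: "\<omega> \<in> closed_codes \<Longrightarrow> hit_pattern \<omega> i = 1 \<longleftrightarrow> decode \<omega> \<inter> V i \<noteq> {}"
  by (simp add: hit_pattern_iff)

lemma inj_hit_pattern: "inj hit_pattern"
proof (rule injI)
  fix a b assume "hit_pattern a = hit_pattern b"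
  then have "inv_into UNIV set_code a = inv_into UNIV set_code b"
    by (auto simp: hit_pattern_def fun_eq_iff of_bool_eq_iff)
  then show "a = b" by (metis bij_inv_eq_iff bij_set_code)
qed

text \<open>The patterns of closed sets are exactly those that are monotone and in which every basic set that is met
contains the closure of arbitrarily small basic sets that are met: such a sequence of smaller and
smaller sets shrinks, by completeness, to a point of the closed set. Both conditions, for fixed
indices, are open, so the patterns form a \<open>G\<^sub>\<delta>\<close> set. The values 0 and 1 are
natural numbers, so that this takes place in the Baire space; for this reason the
bound \<open>h i \<le> 1\<close> is a further open condition.\<close>

lemma hit_patterns_G_delta:
  "(countable intersection_of openin euclidean) (hit_pattern ` closed_codes)"
proof -
  obtain X d where "Metric_space X d" and mc: "Metric_space.mcomplete X d"
    and \<tau>: "\<tau> = Metric_space.mtopology X d"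
    using completely_metrizable unfolding completely_metrizable_space_def by blast
  interpret Metric_space X d by fact
  define refining where "refining i n j \<longleftrightarrow> closure_in (V j) \<subseteq> V i \<and> (\<exists>x\<in>X. V j \<subseteq> mcball x (1 / Suc n)) \<and> V j \<noteq> {}"
    for i n j :: nat
  define A where "A i j = {h :: nat \<Rightarrow> nat. V i \<subseteq> V j \<and> h i = 1 \<longrightarrow> h j = 1}" for i j
  define B where "B i n = {h :: nat \<Rightarrow> nat. h i = 1 \<longrightarrow> (\<exists>j. h j = 1 \<and> refining i n j)}" for i n
  define D where "D i = {h :: nat \<Rightarrow> nat. h i \<le> 1}" for i
  have coord: "open {h :: nat \<Rightarrow> nat. P (h i)}" for i and P :: "nat \<Rightarrow> bool"
    using open_vimage[of "Collect P" "\<lambda>h::nat\<Rightarrow>nat. h i"] by (simp add: vimage_def Topological_Spaces.open_discrete)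
  have "A i j = (if V i \<subseteq> V j then {h. h i \<noteq> 1} \<union> {h. h j = 1} else UNIV)" for i j
    by (auto simp: A_def)
  then have A: "open (A i j)" for i j
    using coord[of "\<lambda>k. k \<noteq> 1" i] coord[of "\<lambda>k. k = 1" j] by auto
  have "B i n = {h. h i \<noteq> 1} \<union> (\<Union>j\<in>{j. refining i n j}. {h. h j = 1})" for i n by (auto simp: B_def)
  then have B: "open (B i n)" for i n
    by (simp only:) (intro open_Un open_UN ballI coord[of "\<lambda>k. k \<noteq> 1"] coord[of "\<lambda>k. k = 1"])
  have D: "open (D i)" for i unfolding D_def by (rule coord[of "\<lambda>k. k \<le> 1"])
  have sub: "closure_in (V j) \<subseteq> V i" "V j \<subseteq> V i" if "refining i n j" for i n j
    using that closure_of_subset[OF openin_subset[OF open_V], of j] by (auto simp: refining_def)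
  have top: "topspace \<tau> = X" by (simp add: \<tau>)
  have dir1: "hit_pattern \<omega> \<in> A i j \<inter> B i n \<inter> D i" if \<omega>: "\<omega> \<in> closed_codes" for \<omega> i j n
  proof -
    have "\<exists>j. decode \<omega> \<inter> V j \<noteq> {} \<and> refining i n j" if hit: "decode \<omega> \<inter> V i \<noteq> {}"
    proof -
      obtain x where x: "x \<in> decode \<omega>" "x \<in> V i" using hit by blast
      have xX: "x \<in> X" using x openin_subset[OF open_V] top by blast
      obtain r where r: "r > 0" "mcball x r \<subseteq> V i"
        using open_V[of i] x(2) unfolding \<tau> openin_mtopology_mcball by blast
      define r' where "r' = min r (1 / Suc n)"
      have r': "r' > 0" "r' \<le> r" "r' \<le> 1 / Suc n" using r by (auto simp: r'_def)
      have "openin \<tau> (mball x r')" by (simp add: \<tau>)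
      moreover have "x \<in> mball x r'" using r' xX by simp
      ultimately obtain j where j: "x \<in> V j" "V j \<subseteq> mball x r'" using base_V by blast
      have j': "V j \<subseteq> mcball x r'" using j(2) mball_subset_mcball by blast
      have "closure_in (V j) \<subseteq> mcball x r'"
        using j' by (intro closure_of_minimal) (simp_all add: \<tau>)
      moreover have "mcball x r' \<subseteq> mcball x r" using r' by (intro mcball_subset_concentric)
      moreover have "mcball x r' \<subseteq> mcball x (1 / Suc n)" using r' by (intro mcball_subset_concentric)
      ultimately have "refining i n j" using j j' r xX unfolding refining_def by blast
      then show ?thesis using x j by blast
    qed
    moreover have "decode \<omega> \<inter> V j \<noteq> {}" if "V i \<subseteq> V j" "decode \<omega> \<inter> V i \<noteq> {}" using that by blast
    ultimately show ?thesis by (auto simp: A_def B_def D_def hit_pattern_iff[OF \<omega>])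
  qed
  have dir2: "h \<in> hit_pattern ` closed_codes" if hA: "\<And>i j. h \<in> A i j" and hB: "\<And>i n. h \<in> B i n"
    and hD: "\<And>i. h \<in> D i" for h
  proof -
    define C where "C = decode (set_code {i. h i = 1})"
    have C: "C = {x \<in> X. \<forall>i. x \<in> V i \<longrightarrow> h i = 1}" by (simp add: C_def decode_def top)
    have clC: "closedin \<tau> C" unfolding C_def by (rule closedin_decode)
    have "C \<inter> V i \<noteq> {}" if hi: "h i = 1" for i
    proof -
      have ex: "\<exists>k. h k = 1 \<and> refining j n k" if "h j = 1" for n j using hB[of j n] that by (auto simp: B_def)
      define js where "js = rec_nat i (\<lambda>n j. SOME k. h k = 1 \<and> refining j n k)"
      have js0: "js 0 = i" and jsS: "js (Suc n) = (SOME k. h k = 1 \<and> refining (js n) n k)" for n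
        by (simp_all add: js_def)
      have hjs: "h (js n) = 1" for n
      proof (induction n)
        case (Suc n) then show ?case using someI_ex[OF ex[of "js n" n]] by (simp add: jsS)
      qed (simp add: js0 hi)
      have refining_js: "refining (js n) n (js (Suc n))" for n
        using someI_ex[OF ex[OF hjs[of n], of n]] by (simp add: jsS)
      define F where "F n = closure_in (V (js (Suc n)))" for n
      have "\<Inter> (range F) \<noteq> {}"
      proof -
        have "closedin mtopology (F n)" for n by (simp add: F_def flip: \<tau>)
        moreover have "F n \<noteq> {}" for n
          using refining_js[of n] closure_of_subset[OF openin_subset[OF open_V], of "js (Suc n)"]
          by (auto simp: F_def refining_def)
        moreover have "decseq F"
        proof (rule decseq_SucI)
          fix n
          show "F (Suc n) \<le> F n" unfolding F_def
            using sub(1)[OF refining_js[of "Suc n"]] closure_of_subset[OF openin_subset[OF open_V], of "js (Suc n)"]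
            by blast
        qed
        moreover have "\<exists>n a. F n \<subseteq> mcball a \<epsilon>" if \<epsilon>: "\<epsilon> > 0" for \<epsilon>
        proof -
          obtain n where n: "1 / Suc n < \<epsilon>" using nat_approx_posE[OF \<epsilon>] by auto
          obtain x where x: "V (js (Suc n)) \<subseteq> mcball x (1 / Suc n)" using refining_js[of n] by (auto simp: refining_def)
          have "F n \<subseteq> mcball x (1 / Suc n)" unfolding F_def
            by (rule closure_of_minimal[OF x]) (simp add: \<tau>)
          also have "\<dots> \<subseteq> mcball x \<epsilon>" using n by (intro mcball_subset_concentric) simp
          finally show ?thesis by blast
        qed
        ultimately show ?thesis using mc unfolding mcomplete_nest by blast
      qed
      then obtain x where "\<And>n. x \<in> F n" by blast
      then have xV: "x \<in> V (js n)" for n using sub(1)[OF refining_js[of n]] unfolding F_def by blast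
      have xX: "x \<in> X" using xV openin_subset[OF open_V] top by blast
      have "h l = 1" if l: "x \<in> V l" for l
      proof -
        obtain r where r: "r > 0" "mball x r \<subseteq> V l"
          using open_V[of l] l unfolding \<tau> openin_mtopology by blast
        obtain n where n: "1 / Suc n < r / 2" using r nat_approx_posE[of "r/2"] by auto
        obtain y where y: "V (js (Suc n)) \<subseteq> mcball y (1 / Suc n)" using refining_js[of n] by (auto simp: refining_def)
        have "V (js (Suc n)) \<subseteq> mball x r"
        proof
          fix z assume z: "z \<in> V (js (Suc n))"
          have yz: "y \<in> X" "z \<in> X" "d y z \<le> 1 / Suc n" "d y x \<le> 1 / Suc n"
            using y z xV[of "Suc n"] by (auto simp del: of_nat_Suc)
          have "d x z \<le> d y x + d y z" using triangle[of x y z] commute[of x y] yz xX by simp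
          then show "z \<in> mball x r" using yz xX n by simp
        qed
        then have "V (js (Suc n)) \<subseteq> V l" using r by blast
        then show "h l = 1" using hA[of "js (Suc n)" l] hjs[of "Suc n"] by (auto simp: A_def)
      qed
      then have "x \<in> C" using xX by (simp add: C)
      then show ?thesis using xV[of 0] js0 by auto
    qed
    moreover have "h i = 1" if "C \<inter> V i \<noteq> {}" for i using that by (auto simp: C)
    ultimately have iff: "h i = 1 \<longleftrightarrow> C \<inter> V i \<noteq> {}" for i by blast
    have "h i = hit_pattern (closed_code C) i" for i
      using iff[of i] hD[of i] by (auto simp: hit_pattern_def closed_code_def D_def)
    then have "h = hit_pattern (closed_code C)" by (rule ext)
    then show ?thesis using code_in_closed_codes[OF clC] by blast
  qed
  have "hit_pattern ` closed_codes = \<Inter> (range (\<lambda>(i, j). A i j) \<union> range (\<lambda>(i, n). B i n) \<union> range D)"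
  proof
    show "hit_pattern ` closed_codes \<subseteq> \<Inter> (range (\<lambda>(i, j). A i j) \<union> range (\<lambda>(i, n). B i n) \<union> range D)"
      using dir1 by auto
    show "\<Inter> (range (\<lambda>(i, j). A i j) \<union> range (\<lambda>(i, n). B i n) \<union> range D) \<subseteq> hit_pattern ` closed_codes"
    proof
      fix h assume "h \<in> \<Inter> (range (\<lambda>(i, j). A i j) \<union> range (\<lambda>(i, n). B i n) \<union> range D)"
      then have "h \<in> A i j" "h \<in> B i n" "h \<in> D i" for i j n by auto
      then show "h \<in> hit_pattern ` closed_codes" by (rule dir2)
    qed
  qed
  then show ?thesis unfolding intersection_of_def using A B D
    by (intro exI[of _ "range (\<lambda>(i, j). A i j) \<union> range (\<lambda>(i, n). B i n) \<union> range D"]) auto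
qed

text \<open>A \<open>G\<^sub>\<delta>\<close> set in a Polish space is Polish, and the Borel sets of the topology pulled back from the space of
patterns are generated by its coordinates, that is, by the events that basic sets are met.\<close>

theorem standard_Borel_Effros:
  assumes sets_\<Omega>: "sets \<Omega> = sets Effros"
  shows "standard_Borel_space \<Omega>"
proof -
  define Z where "Z = subtopology euclidean (hit_pattern ` closed_codes)"
  define \<tau>\<Omega> where "\<tau>\<Omega> = pullback_topology closed_codes hit_pattern Z"
  define g where "g h = inv_into UNIV hit_pattern h" for h
  have gh: "g (hit_pattern \<omega>) = \<omega>" for \<omega> unfolding g_def by (rule inv_f_f[OF inj_hit_pattern])
  have topZ: "topspace Z = hit_pattern ` closed_codes" by (simp add: Z_def)
  have top: "topspace \<tau>\<Omega> = closed_codes"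
    unfolding \<tau>\<Omega>_def topspace_pullback_topology topZ by auto
  have "homeomorphic_maps \<tau>\<Omega> Z hit_pattern g"
    unfolding homeomorphic_maps_def
  proof (intro conjI ballI)
    show "continuous_map \<tau>\<Omega> Z hit_pattern"
      using continuous_map_pullback[OF continuous_map_id, of closed_codes hit_pattern Z]
      by (simp add: \<tau>\<Omega>_def)
    have "continuous_map Z Z (hit_pattern \<circ> g)"
      by (rule continuous_map_eq[OF continuous_map_id]) (auto simp: topZ gh)
    then show "continuous_map Z \<tau>\<Omega> g"
      unfolding \<tau>\<Omega>_def by (rule continuous_map_pullback') (auto simp: topZ gh)
  qed (auto simp: gh top topZ)
  then have homeo: "\<tau>\<Omega> homeomorphic_space Z" unfolding homeomorphic_space_def by blast
  have "completely_metrizable_space Z" unfolding Z_def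
    by (rule completely_metrizable_space_gdelta_in_alt[OF completely_metrizable_Baire hit_patterns_G_delta])
  moreover have "second_countable Z" unfolding Z_def
    by (intro second_countable_subtopology second_countable_euclidean)
  ultimately have "Polish_topology \<tau>\<Omega>"
    using homeo homeomorphic_completely_metrizable_space homeomorphic_space_second_countability
    unfolding Polish_topology_def by blast
  moreover have sp: "space \<Omega> = closed_codes" using sets_eq_imp_space_eq[OF sets_\<Omega>] by simp
  moreover have "sets \<Omega> = sets (borel_of \<tau>\<Omega>)"
  proof -
    note sb = sets_borel_of[of \<tau>\<Omega>, unfolded top]
    have "(\<lambda>\<omega>. hit_pattern \<omega> i) \<in> borel_measurable Effros" for i
    proof (rule measurable_If[where f="\<lambda>_. 1" and g="\<lambda>_. 0", THEN measurable_cong[THEN iffD1, rotated]])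
      show "{\<omega> \<in> space Effros. decode \<omega> \<inter> V i \<noteq> {}} \<in> sets Effros"
        using base_hit_in_Effros[of i] by simp
    qed (auto simp: hit_pattern_iff)
    then have hp: "hit_pattern \<in> borel_measurable Effros"
      by (rule measurable_coordinatewise_then_product)
    have "sigma_sets closed_codes {U. openin \<tau>\<Omega> U} \<subseteq> sets Effros"
    proof -
      have "U \<in> sets Effros" if U: "openin \<tau>\<Omega> U" for U
      proof -
        obtain S where "openin Z S" and U1: "U = hit_pattern -` S \<inter> closed_codes"
          using U unfolding \<tau>\<Omega>_def openin_pullback_topology by blast
        then obtain S' where S': "open S'" "S = S' \<inter> hit_pattern ` closed_codes"
          unfolding Z_def openin_subtopology by auto
        have "U = hit_pattern -` S' \<inter> space Effros" using U1 S' by auto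
        then show ?thesis using measurable_sets[OF hp, of S'] S' by simp
      qed
      then show ?thesis using sets.sigma_sets_subset[of "{U. openin \<tau>\<Omega> U}" Effros] by auto
    qed
    moreover have "sets Effros \<subseteq> sigma_sets closed_codes {U. openin \<tau>\<Omega> U}"
      unfolding sets_Effros
    proof (rule sigma_sets_mono', safe)
      fix i
      have "open {h :: nat \<Rightarrow> nat. h i = 1}"
        using open_vimage[of "{1}" "\<lambda>h::nat\<Rightarrow>nat. h i"] by (simp add: vimage_def Topological_Spaces.open_discrete)
      then have "openin Z ({h. h i = 1} \<inter> hit_pattern ` closed_codes)"
        unfolding Z_def openin_subtopology by auto
      then have "openin \<tau>\<Omega> (hit_pattern -` ({h. h i = 1} \<inter> hit_pattern ` closed_codes) \<inter> closed_codes)"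
        unfolding \<tau>\<Omega>_def openin_pullback_topology by blast
      also have "hit_pattern -` ({h. h i = 1} \<inter> hit_pattern ` closed_codes) \<inter> closed_codes
          = {\<omega> \<in> closed_codes. hit_pattern \<omega> i = 1}"
        by auto
      also have "\<dots> = {\<omega> \<in> closed_codes. decode \<omega> \<inter> V i \<noteq> {}}"
        using hit_pattern_eq_1_iff by blast
      finally show "openin \<tau>\<Omega> {\<omega> \<in> closed_codes. decode \<omega> \<inter> V i \<noteq> {}}" .
    qed
    ultimately show ?thesis using sets_\<Omega> sb by blast
  qed
  ultimately show ?thesis
    unfolding standard_Borel_space_def generating_Polish_topology_def using top by auto
qed

end

lemma Polish_base_exists:
  assumes "Polish_topology \<tau>"
  obtains V where "Polish_base \<tau> V"
proof -
  from assms have cm: "completely_metrizable_space \<tau>" and "second_countable \<tau>"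
    by (auto simp: Polish_topology_def)
  then obtain B where B: "countable B" "\<And>W. W \<in> B \<Longrightarrow> openin \<tau> W"
    "\<And>U x. openin \<tau> U \<Longrightarrow> x \<in> U \<Longrightarrow> \<exists>W\<in>B. x \<in> W \<and> W \<subseteq> U"
    unfolding second_countable_def by metis
  define V where "V = from_nat_into (insert {} B)"
  have rV: "range V = insert {} B" unfolding V_def using B(1) by (intro range_from_nat_into) auto
  have "Polish_base \<tau> V"
  proof
    show "openin \<tau> (V i)" for i using rV B(2) openin_empty by (metis insertE rangeI)
    show "\<exists>i. x \<in> V i \<and> V i \<subseteq> U" if "openin \<tau> U" "x \<in> U" for U x
      using B(3)[OF that] rV by (metis imageE insertCI)
  qed (rule cm)
  then show thesis by (rule that)
qed

context Polish_base
begin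

lemma Hausdorff: "Hausdorff_space \<tau>"
  by (rule metrizable_imp_Hausdorff_space)
    (rule completely_metrizable_imp_metrizable_space[OF completely_metrizable])

lemma closedin_finite: "finite F \<Longrightarrow> F \<subseteq> topspace \<tau> \<Longrightarrow> closedin \<tau> F"
  using Hausdorff_imp_t1_space[OF Hausdorff] by (simp add: t1_space_closedin_finite)

lemma separate_finite_by_base:
  assumes U: "openin \<tau> U" and F: "finite F" "F \<subseteq> U"
  obtains v where "\<And>x. x \<in> F \<Longrightarrow> x \<in> V (v x) \<and> V (v x) \<subseteq> U"
    and "\<And>x y. x \<in> F \<Longrightarrow> y \<in> F \<Longrightarrow> x \<noteq> y \<Longrightarrow> V (v x) \<inter> V (v y) = {}"
proof -
  have FX: "F \<subseteq> topspace \<tau>" using F openin_subset[OF U] by blast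
  have "\<exists>p. openin \<tau> (fst p) \<and> openin \<tau> (snd p) \<and> x \<in> fst p \<and> y \<in> snd p \<and> fst p \<inter> snd p = {}"
    if "x \<in> F" "y \<in> F" "x \<noteq> y" for x y
    using Hausdorff that FX unfolding Hausdorff_space_def disjnt_def by (metis fst_conv snd_conv subsetD)
  then obtain p where p: "\<And>x y. x \<in> F \<Longrightarrow> y \<in> F \<Longrightarrow> x \<noteq> y \<Longrightarrow>
      openin \<tau> (fst (p x y)) \<and> openin \<tau> (snd (p x y)) \<and> x \<in> fst (p x y) \<and> y \<in> snd (p x y)
      \<and> fst (p x y) \<inter> snd (p x y) = {}"
    by metis
  define N where "N x = \<Inter> (insert U ((\<lambda>y. fst (p x y) \<inter> snd (p y x)) ` (F - {x})))" for x
  have N: "openin \<tau> (N x)" "x \<in> N x" "N x \<subseteq> U" if x: "x \<in> F" for x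
  proof -
    show "openin \<tau> (N x)" unfolding N_def
      using F U p x by (intro openin_Inter) (auto intro!: openin_Int)
    show "x \<in> N x" using p x F by (auto simp: N_def)
  qed (auto simp: N_def)
  have dis: "N x \<inter> N y = {}" if "x \<in> F" "y \<in> F" "x \<noteq> y" for x y
  proof -
    have "N x \<subseteq> fst (p x y)" "N y \<subseteq> snd (p x y)" using that by (auto simp: N_def)
    then show ?thesis using p[OF that] by blast
  qed
  have "\<exists>i. x \<in> V i \<and> V i \<subseteq> N x" if "x \<in> F" for x using base_V N that by blast
  then obtain v where v: "\<And>x. x \<in> F \<Longrightarrow> x \<in> V (v x) \<and> V (v x) \<subseteq> N x" by metis
  show thesis
  proof (rule that[of v])
    show "x \<in> V (v x) \<and> V (v x) \<subseteq> U" if "x \<in> F" for x using v[OF that] N(3)[OF that] by blast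
    show "V (v x) \<inter> V (v y) = {}" if "x \<in> F" "y \<in> F" "x \<noteq> y" for x y
      using v[OF that(1)] v[OF that(2)] dis[OF that] by blast
  qed
qed

text \<open>A closed set has at least \<open>k\<close> points in an open set \<open>U\<close> if and only if it meets \<open>k\<close> disjoint basic
sets inside \<open>U\<close>, and there are only countably many choices of these.\<close>

lemma measurable_count_open:
  assumes U: "openin \<tau> U"
  shows "(\<lambda>\<omega>. ecard (decode \<omega> \<inter> U)) \<in> measurable Effros (count_space UNIV)"
proof (rule measurable_enat_ge)
  fix k
  define \<J> where "\<J> = {J. finite J \<and> card J = k \<and> (\<forall>j\<in>J. V j \<subseteq> U) \<and> (\<forall>i\<in>J. \<forall>j\<in>J. i \<noteq> j \<longrightarrow> V i \<inter> V j = {})}"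
  have "{\<omega> \<in> space Effros. enat k \<le> ecard (decode \<omega> \<inter> U)}
      = (\<Union>J\<in>\<J>. {\<omega> \<in> space Effros. \<forall>j\<in>J. decode \<omega> \<inter> V j \<noteq> {}})"
  proof (intro Set.set_eqI iffI)
    fix \<omega> assume "\<omega> \<in> {\<omega> \<in> space Effros. enat k \<le> ecard (decode \<omega> \<inter> U)}"
    then obtain F where \<omega>: "\<omega> \<in> space Effros" and F: "finite F" "F \<subseteq> decode \<omega> \<inter> U" "card F = k"
      by (auto simp: enat_le_ecard_iff)
    have "F \<subseteq> U" using F by blast
    then obtain v where v: "\<And>x. x \<in> F \<Longrightarrow> x \<in> V (v x) \<and> V (v x) \<subseteq> U"
      and dis: "\<And>x y. x \<in> F \<Longrightarrow> y \<in> F \<Longrightarrow> x \<noteq> y \<Longrightarrow> V (v x) \<inter> V (v y) = {}"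
      using separate_finite_by_base[OF U F(1)] by blast
    have "inj_on v F"
    proof (rule inj_onI, rule ccontr)
      fix x y assume "x \<in> F" "y \<in> F" "v x = v y" "x \<noteq> y"
      then show False using dis[of x y] v[of x] by auto
    qed
    then have "v ` F \<in> \<J>" using F v dis unfolding \<J>_def by (auto simp: card_image) blast
    moreover have "\<forall>j\<in>v ` F. decode \<omega> \<inter> V j \<noteq> {}" using v F by blast
    ultimately show "\<omega> \<in> (\<Union>J\<in>\<J>. {\<omega> \<in> space Effros. \<forall>j\<in>J. decode \<omega> \<inter> V j \<noteq> {}})"
      using \<omega> by blast
  next
    fix \<omega> assume "\<omega> \<in> (\<Union>J\<in>\<J>. {\<omega> \<in> space Effros. \<forall>j\<in>J. decode \<omega> \<inter> V j \<noteq> {}})"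
    then obtain J where \<omega>: "\<omega> \<in> space Effros" and J: "J \<in> \<J>" and "\<forall>j\<in>J. \<exists>x. x \<in> decode \<omega> \<inter> V j"
      by blast
    then obtain x where x: "\<And>j. j \<in> J \<Longrightarrow> x j \<in> decode \<omega> \<inter> V j" by metis
    have "inj_on x J"
    proof (rule inj_onI, rule ccontr)
      fix i j assume "i \<in> J" "j \<in> J" "x i = x j" "i \<noteq> j"
      moreover from this have "V i \<inter> V j = {}" using J unfolding \<J>_def by blast
      ultimately show False using x[of i] x[of j] by auto
    qed
    then have "finite (x ` J) \<and> x ` J \<subseteq> decode \<omega> \<inter> U \<and> card (x ` J) = k"
      using J x by (auto simp: \<J>_def card_image)
    then show "\<omega> \<in> {\<omega> \<in> space Effros. enat k \<le> ecard (decode \<omega> \<inter> U)}"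
      using \<omega> unfolding enat_le_ecard_iff by blast
  qed
  also have "\<dots> \<in> sets Effros"
  proof (rule sets.countable_UN'')
    show "countable \<J>"
      by (rule countable_subset[OF _ countable_Collect_finite]) (auto simp: \<J>_def)
    show "{\<omega> \<in> space Effros. \<forall>j\<in>J. decode \<omega> \<inter> V j \<noteq> {}} \<in> sets Effros" if "J \<in> \<J>" for J
      using that base_hit_in_Effros by (intro sets.sets_Collect_finite_All) (auto simp: \<J>_def)
  qed
  finally show "{\<omega> \<in> space Effros. enat k \<le> ecard (decode \<omega> \<inter> U)} \<in> sets Effros" .
qed

text \<open>The law of a random closed set is determined by its void probabilities: avoiding
\<open>U\<close> and avoiding \<open>U'\<close> together mean avoiding \<open>U \<union> U'\<close>, so the void events are closed under
intersection, and they generate the sigma-algebra.\<close>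

lemma Effros_measure_eqI:
  assumes N: "prob_space N" "sets N = sets Effros" and L: "prob_space L" "sets L = sets Effros"
    and void: "\<And>U. openin \<tau> U \<Longrightarrow>
      emeasure N {\<omega> \<in> closed_codes. decode \<omega> \<inter> U = {}} = emeasure L {\<omega> \<in> closed_codes. decode \<omega> \<inter> U = {}}"
  shows "N = L"
proof -
  interpret N: prob_space N by fact
  define vd where "vd U = {\<omega> \<in> closed_codes. decode \<omega> \<inter> U = {}}" for U
  have gen: "sets Effros = sigma_sets closed_codes {vd U | U. openin \<tau> U}"
  proof
    show "sets Effros \<subseteq> sigma_sets closed_codes {vd U | U. openin \<tau> U}"
      unfolding sets_Effros
    proof (rule sigma_sets_mono, safe)
      fix i
      have "{\<omega> \<in> closed_codes. decode \<omega> \<inter> V i \<noteq> {}} = closed_codes - vd (V i)" by (auto simp: vd_def)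
      also have "\<dots> \<in> sigma_sets closed_codes {vd U | U. openin \<tau> U}"
        using open_V by (intro sigma_sets.Compl sigma_sets.Basic) auto
      finally show "{\<omega> \<in> closed_codes. decode \<omega> \<inter> V i \<noteq> {}} \<in> sigma_sets closed_codes {vd U | U. openin \<tau> U}" .
    qed
    have "vd U \<in> sets Effros" if "openin \<tau> U" for U
    proof -
      have "vd U = space Effros - {\<omega> \<in> closed_codes. decode \<omega> \<inter> U \<noteq> {}}" by (auto simp: vd_def)
      then show ?thesis using sets.compl_sets[OF open_hit_in_Effros[OF that]] by simp
    qed
    then show "sigma_sets closed_codes {vd U | U. openin \<tau> U} \<subseteq> sets Effros"
      using sets.sigma_sets_subset[of "{vd U | U. openin \<tau> U}" Effros] by auto
  qed
  show ?thesis
  proof (rule measure_eqI_generator_eq[where E="{vd U | U. openin \<tau> U}" and \<Omega>=closed_codes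
        and A="\<lambda>_. closed_codes"])
    show "Int_stable {vd U | U. openin \<tau> U}"
    proof (rule Int_stableI)
      fix a b assume "a \<in> {vd U | U. openin \<tau> U}" "b \<in> {vd U | U. openin \<tau> U}"
      then obtain A B where AB: "openin \<tau> A" "openin \<tau> B" "a = vd A" "b = vd B" by auto
      then have "a \<inter> b = vd (A \<union> B)" by (auto simp: vd_def)
      then show "a \<inter> b \<in> {vd U | U. openin \<tau> U}" using AB by auto
    qed
    show "{vd U | U. openin \<tau> U} \<subseteq> Pow closed_codes" by (auto simp: vd_def)
    show "emeasure N X = emeasure L X" if "X \<in> {vd U | U. openin \<tau> U}" for X
      using that void by (auto simp: vd_def)
    show "sets N = sigma_sets closed_codes {vd U | U. openin \<tau> U}"
      "sets L = sigma_sets closed_codes {vd U | U. openin \<tau> U}" using N L gen by auto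
    have "closed_codes = vd {}" by (auto simp: vd_def)
    then show "range (\<lambda>_::nat. closed_codes) \<subseteq> {vd U | U. openin \<tau> U}" by auto
    show "emeasure N closed_codes \<noteq> \<infinity>" by simp
  qed auto
qed

text \<open>Countably many events separate the points. From an atom, remove for each of these events the part, inside or outside of
it, that carries no mass: what is left has full mass and at most one point.\<close>

lemma nonatomic_if_singletons_null:
  assumes N: "sets N = sets Effros" and null: "\<And>\<omega>. \<omega> \<in> closed_codes \<Longrightarrow> emeasure N {\<omega>} = 0"
  shows "nonatomic N"
  unfolding nonatomic_def
proof
  assume "\<exists>A. is_atom N A"
  then obtain A where A: "A \<in> sets N" "0 < emeasure N A"
    and atom: "\<And>B. B \<in> sets N \<Longrightarrow> B \<subseteq> A \<Longrightarrow> emeasure N B = 0 \<or> emeasure N (A - B) = 0"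
    by (auto simp: is_atom_def)
  have sp: "space N = closed_codes" using sets_eq_imp_space_eq[OF N] by simp
  define H where "H i = {\<omega> \<in> closed_codes. decode \<omega> \<inter> V i \<noteq> {}}" for i
  have H: "H i \<in> sets N" for i using base_hit_in_Effros N by (simp add: H_def)
  define B where "B i = (if emeasure N (A - H i) = 0 then H i else space N - H i)" for i
  have B: "B i \<in> sets N" for i using H by (auto simp: B_def)
  have AB: "A - B i \<in> null_sets N" for i
  proof (cases "emeasure N (A - H i) = 0")
    case True
    then show ?thesis using A H by (auto simp: B_def)
  next
    case False
    have "A - A \<inter> H i = A - H i" by auto
    then have "emeasure N (A \<inter> H i) = 0" using atom[of "A \<inter> H i"] A H False by auto
    moreover have "A - B i = A \<inter> H i" using sets.sets_into_space[OF A(1)] False by (auto simp: B_def)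
    ultimately show ?thesis using A H by auto
  qed
  define D where "D = A \<inter> (\<Inter>i. B i)"
  have "A - D = (\<Union>i. A - B i)" by (auto simp: D_def)
  then have AD: "A - D \<in> null_sets N" using AB null_sets_UN[of "\<lambda>i. A - B i" N] by auto
  have D: "D \<in> sets N" using A B by (auto simp: D_def)
  have eq: "\<omega> = \<omega>'" if "\<omega> \<in> D" "\<omega>' \<in> D" for \<omega> \<omega>'
  proof -
    have cc: "\<omega> \<in> closed_codes" "\<omega>' \<in> closed_codes"
      using that sets.sets_into_space[OF D] sp by auto
    have "\<omega> \<in> H i \<longleftrightarrow> \<omega>' \<in> H i" for i
    proof -
      have "\<omega> \<in> B i" "\<omega>' \<in> B i" using that by (auto simp: D_def)
      then show ?thesis by (simp add: B_def split: if_splits)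
    qed
    then have "decode \<omega> \<inter> V i \<noteq> {} \<longleftrightarrow> decode \<omega>' \<inter> V i \<noteq> {}" for i using cc by (auto simp: H_def)
    then have "closed_code (decode \<omega>) = closed_code (decode \<omega>')" by (simp add: closed_code_def)
    then show ?thesis using code_decode cc by metis
  qed
  have "emeasure N D = 0"
  proof (cases "D = {}")
    case False
    then obtain \<omega> where "\<omega> \<in> D" by auto
    then have "D = {\<omega>}" "\<omega> \<in> closed_codes" using eq sets.sets_into_space[OF D] sp by auto
    then show ?thesis using null by simp
  qed simp
  then have "D \<in> null_sets N" using D by auto
  then have "D \<union> (A - D) \<in> null_sets N" using AD by (rule null_sets.Un)
  moreover have "D \<union> (A - D) = A" by (auto simp: D_def)
  ultimately show False using A by auto
qed

lemma point_in_borel_of: "x \<in> topspace \<tau> \<Longrightarrow> {x} \<in> sets (borel_of \<tau>)"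
proof -
  assume x: "x \<in> topspace \<tau>"
  then have "closedin \<tau> {x}" by (intro closedin_finite) auto
  then have "openin \<tau> (topspace \<tau> - {x})" by blast
  from sets.compl_sets[OF open_in_borel_of[OF this]] x show ?thesis
    by (simp add: space_borel_of double_diff)
qed

end

section \<open>The law of a Poisson configuration\<close>

locale random_configuration = Polish_base \<tau> V + poisson_sampling M c \<nu>
  for \<tau> :: "'a topology" and V :: "nat \<Rightarrow> 'a set" and M :: "'a measure"
    and c :: "nat \<Rightarrow> real" and \<nu> :: "nat \<Rightarrow> 'a measure" +
  assumes sets_M: "sets M = sets (borel_of \<tau>)"
    and locally_finite: "locally_finite_measure_on \<tau> M"
    and null_point: "x \<in> space M \<Longrightarrow> emeasure M {x} = 0"
    and null_\<nu>: "x \<in> space M \<Longrightarrow> emeasure (\<nu> n) {x} = 0"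
begin

lemma sets_M_sigma: "sets M = sigma_sets (topspace \<tau>) {U. openin \<tau> U}"
  unfolding sets_M by (rule sets_borel_of)

lemma space_M: "space M = topspace \<tau>"
  using sets_eq_imp_space_eq[OF sets_M] by (simp add: space_borel_of)

lemma open_in_M: "openin \<tau> U \<Longrightarrow> U \<in> sets M"
  unfolding sets_M by (rule open_in_borel_of)

text \<open>Countably many open sets of finite measure that cover the space: this is where local finiteness
and second countability enter.\<close>

definition patch :: "nat \<Rightarrow> 'a set" where
  "patch m = (if emeasure M (V m) < \<infinity> then V m else {})"

lemma open_patch: "openin \<tau> (patch m)" and patch_in_M: "patch m \<in> sets M"
  and finite_patch: "emeasure M (patch m) < \<infinity>"
  using open_V open_in_M by (auto simp: patch_def)

lemma UN_patch: "(\<Union>m. patch m) = topspace \<tau>"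
proof
  show "(\<Union>m. patch m) \<subseteq> topspace \<tau>" using open_patch openin_subset by blast
  show "topspace \<tau> \<subseteq> (\<Union>m. patch m)"
  proof
    fix x assume "x \<in> topspace \<tau>"
    then obtain W where W: "openin \<tau> W" "x \<in> W" "emeasure M W < \<infinity>"
      using locally_finite by (auto simp: locally_finite_measure_on_def)
    then obtain i where i: "x \<in> V i" "V i \<subseteq> W" using base_V by blast
    have "emeasure M (V i) \<le> emeasure M W" using i open_in_M[OF W(1)] by (intro emeasure_mono)
    then have "x \<in> patch i" using i W(3) by (simp add: patch_def)
    then show "x \<in> (\<Union>m. patch m)" by blast
  qed
qed

lemma diagonal_measurable: "{p \<in> space (M \<Otimes>\<^sub>M M). fst p = snd p} \<in> sets (M \<Otimes>\<^sub>M M)"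
proof -
  define R where "R = (\<Union>p\<in>{p. V (fst p) \<inter> V (snd p) = {}}. V (fst p) \<times> V (snd p))"
  have R: "R \<in> sets (M \<Otimes>\<^sub>M M)"
    unfolding R_def using open_V open_in_M by (intro sets.countable_UN'') auto
  have "{p \<in> space (M \<Otimes>\<^sub>M M). fst p = snd p} = space (M \<Otimes>\<^sub>M M) - R"
  proof -
    have "(x, y) \<in> R" if xy: "x \<in> topspace \<tau>" "y \<in> topspace \<tau>" "x \<noteq> y" for x y
    proof -
      obtain v where v: "\<And>z. z \<in> {x, y} \<Longrightarrow> z \<in> V (v z) \<and> V (v z) \<subseteq> topspace \<tau>"
        "\<And>z z'. z \<in> {x, y} \<Longrightarrow> z' \<in> {x, y} \<Longrightarrow> z \<noteq> z' \<Longrightarrow> V (v z) \<inter> V (v z') = {}"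
        using separate_finite_by_base[OF openin_topspace, of "{x, y}"] xy by (metis bot.extremum finite.simps insert_subset)
      then have "V (v x) \<inter> V (v y) = {}" "x \<in> V (v x)" "y \<in> V (v y)" using xy by auto
      then show ?thesis unfolding R_def by (intro UN_I[of "(v x, v y)"]) auto
    qed
    moreover have "(x, x) \<notin> R" for x by (auto simp: R_def)
    ultimately have "x = y \<longleftrightarrow> (x, y) \<notin> R" if "x \<in> topspace \<tau>" "y \<in> topspace \<tau>" for x y
      using that by metis
    then show ?thesis by (auto simp: space_pair_measure space_M)
  qed
  then show ?thesis using R by auto
qed

definition points :: "(nat \<Rightarrow> nat) \<times> (nat \<times> nat \<Rightarrow> 'a) \<Rightarrow> 'a set" where
  "points w = snd w ` sampled w"

text \<open>Taking the closure makes the configuration a closed set for every sample; almost surely it adds no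
points.\<close>

definition configuration :: "(nat \<Rightarrow> nat) \<times> (nat \<times> nat \<Rightarrow> 'a) \<Rightarrow> real" where
  "configuration w = closed_code (closure_in (points w))"

definition config_law :: "real measure" where
  "config_law = distr sample_space Effros configuration"

definition tame :: "real set" where
  "tame = {\<omega> \<in> closed_codes. \<forall>m. finite (decode \<omega> \<inter> patch m)}"

text \<open>For a Borel set \<open>A\<close>, the event that a closed set meets \<open>A\<close> is in general only analytic. On \<open>tame\<close>,
which has full measure, the number of points in \<open>A\<close> is measurable; elsewhere it is replaced by 0.
The set \<open>tame\<close> depends on the choice of the patches and need not be invariant under the action, whence
the counts are transformed by the action only almost everywhere.\<close>

definition point_count :: "'a set \<Rightarrow> real \<Rightarrow> enat" where
  "point_count A \<omega> = (if \<omega> \<in> tame then ecard (decode \<omega> \<inter> A) else 0)"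

lemma sets_config_law [simp]: "sets config_law = sets Effros"
  by (simp add: config_law_def)

lemma space_config_law [simp]: "space config_law = closed_codes"
  by (simp add: config_law_def)

lemma measurable_configuration: "configuration \<in> measurable sample_space Effros"
proof (rule measurable_into_Effros)
  show "configuration w \<in> closed_codes" for w
    unfolding configuration_def by (intro code_in_closed_codes closedin_closure_of)
  fix i
  have "decode (configuration w) \<inter> V i \<noteq> {} \<longleftrightarrow> (\<exists>j. j \<in> hits (V i) w)" for w
  proof -
    have "decode (configuration w) \<inter> V i \<noteq> {} \<longleftrightarrow> points w \<inter> V i \<noteq> {}"
      unfolding configuration_def decode_code[OF closedin_closure_of]
      using openin_Int_closure_of_eq_empty[OF open_V, of i "points w"] by (metis inf_commute)
    then show ?thesis by (auto simp: points_def hits_def)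
  qed
  then have "{w \<in> space sample_space. decode (configuration w) \<inter> V i \<noteq> {}}
      = (\<Union>j. {w \<in> space sample_space. j \<in> hits (V i) w})" by auto
  also have "\<dots> \<in> sets sample_space"
    by (intro sets.countable_UN'' sets_hits open_in_M open_V) auto
  finally show "{w \<in> space sample_space. decode (configuration w) \<inter> V i \<noteq> {}} \<in> sets sample_space" .
qed

lemma prob_config_law: "prob_space config_law"
  unfolding config_law_def
  by (rule prob_space.prob_space_distr[OF prob_sample_space measurable_configuration])

lemma tame_measurable: "tame \<in> sets Effros"
proof -
  have "tame = (\<Inter>m. (\<lambda>\<omega>. ecard (decode \<omega> \<inter> patch m)) -` (- {\<infinity>}) \<inter> space Effros)"
    by (auto simp: tame_def ecard_def)
  also have "\<dots> \<in> sets Effros"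
    using measurable_sets[OF measurable_count_open[OF open_patch]] by (intro sets.countable_INT) auto
  finally show ?thesis .
qed

text \<open>On a tame configuration the patch has finitely many points, so the count of a complement is a
difference; this makes the sets with measurable count a Dynkin system containing the open sets.\<close>

lemma measurable_count_in_patch:
  assumes A: "A \<in> sets M"
  shows "(\<lambda>\<omega>. indicator tame \<omega> * emeasure (count_space UNIV) (decode \<omega> \<inter> (patch m \<inter> A)))
    \<in> borel_measurable Effros" (is "?f A \<in> _")
proof -
  have ind [measurable]: "indicator tame \<in> borel_measurable Effros" using tame_measurable by simp
  have opn: "(\<lambda>\<omega>. emeasure (count_space UNIV) (decode \<omega> \<inter> U)) \<in> borel_measurable Effros"
    if "openin \<tau> U" for U
    using measurable_compose[OF measurable_count_open[OF that], of ennreal_of_enat borel]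
    by (simp add: ennreal_of_enat_ecard)
  have "Int_stable {U. openin \<tau> U}" by (rule Int_stableI) auto
  moreover have "{U. openin \<tau> U} \<subseteq> Pow (topspace \<tau>)" using openin_subset by auto
  moreover have "A \<in> sigma_sets (topspace \<tau>) {U. openin \<tau> U}" using A sets_M_sigma by simp
  ultimately show ?thesis
  proof (induction rule: sigma_sets_induct_disjoint)
    case (basic A)
    then have [measurable]: "(\<lambda>\<omega>. emeasure (count_space UNIV) (decode \<omega> \<inter> (patch m \<inter> A))) \<in> borel_measurable Effros"
      by (intro opn openin_Int open_patch) auto
    show ?case by measurable
  next
    case empty
    show ?case by simp
  next
    case (compl A)
    note compl.IH[measurable]
    have [measurable]: "(\<lambda>\<omega>. emeasure (count_space UNIV) (decode \<omega> \<inter> patch m)) \<in> borel_measurable Effros"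
      by (intro opn open_patch)
    have "?f (topspace \<tau> - A) \<omega>
        = indicator tame \<omega> * emeasure (count_space UNIV) (decode \<omega> \<inter> patch m) - ?f A \<omega>" for \<omega>
    proof (cases "\<omega> \<in> tame")
      case True
      have "decode \<omega> \<inter> (patch m \<inter> (topspace \<tau> - A)) = decode \<omega> \<inter> patch m - decode \<omega> \<inter> (patch m \<inter> A)"
        using openin_subset[OF open_patch] by blast
      moreover have "finite (decode \<omega> \<inter> (patch m \<inter> A))"
      proof (rule finite_subset)
        show "finite (decode \<omega> \<inter> patch m)" using True by (simp add: tame_def)
      qed blast
      then have "emeasure (count_space UNIV) (decode \<omega> \<inter> patch m - decode \<omega> \<inter> (patch m \<inter> A))
          = emeasure (count_space UNIV) (decode \<omega> \<inter> patch m)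
            - emeasure (count_space UNIV) (decode \<omega> \<inter> (patch m \<inter> A))"
        by (intro emeasure_Diff) auto
      ultimately show ?thesis using True by simp
    qed simp
    then show ?case by simp
  next
    case (union A)
    note union.IH[measurable]
    have "?f (\<Union>i. A i) \<omega> = (\<Sum>i. ?f (A i) \<omega>)" for \<omega>
    proof -
      have "(\<Sum>i. emeasure (count_space UNIV) (decode \<omega> \<inter> (patch m \<inter> A i)))
          = emeasure (count_space UNIV) (\<Union>i. decode \<omega> \<inter> (patch m \<inter> A i))"
        using union(1) by (intro suminf_emeasure) (auto simp: disjoint_family_on_def)
      also have "(\<Union>i. decode \<omega> \<inter> (patch m \<inter> A i)) = decode \<omega> \<inter> (patch m \<inter> (\<Union>i. A i))" by auto
      finally show ?thesis by (cases "\<omega> \<in> tame") simp_all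
    qed
    then have "?f (\<Union>i. A i) = (\<lambda>\<omega>. \<Sum>i. ?f (A i) \<omega>)" by (rule ext)
    then show ?case by (simp only:) (intro borel_measurable_suminf_order union.IH)
  qed
qed

lemma measurable_point_count:
  assumes A: "A \<in> sets M"
  shows "point_count A \<in> measurable Effros (count_space UNIV)"
proof -
  define B where "B m = A \<inter> disjointed patch m" for m
  have B: "B m \<in> sets M" for m
    using A sets.range_disjointed_sets[of patch M] patch_in_M by (auto simp: B_def)
  have eq: "ennreal_of_enat (point_count A \<omega>)
      = (\<Sum>m. indicator tame \<omega> * emeasure (count_space UNIV) (decode \<omega> \<inter> (patch m \<inter> B m)))" for \<omega>
  proof (cases "\<omega> \<in> tame")
    case True
    have "patch m \<inter> B m = A \<inter> disjointed patch m" for m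
      using disjointed_subset[of patch m] by (auto simp: B_def)
    then have "(\<Union>m. decode \<omega> \<inter> (patch m \<inter> B m)) = decode \<omega> \<inter> (A \<inter> (\<Union>m. disjointed patch m))"
      by simp
    also have "A \<inter> (\<Union>m. disjointed patch m) = A"
      using sets.sets_into_space[OF A] by (simp add: UN_disjointed_eq UN_patch space_M Int_absorb2)
    finally have "decode \<omega> \<inter> A = (\<Union>m. decode \<omega> \<inter> (patch m \<inter> B m))" by simp
    moreover have "(\<Sum>m. emeasure (count_space UNIV) (decode \<omega> \<inter> (patch m \<inter> B m)))
        = emeasure (count_space UNIV) (\<Union>m. decode \<omega> \<inter> (patch m \<inter> B m))"
      using disjoint_family_disjointed[of patch]
      by (intro suminf_emeasure) (auto simp: disjoint_family_on_def B_def)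
    ultimately show ?thesis using True by (simp add: point_count_def ennreal_of_enat_ecard)
  qed (simp add: point_count_def)
  have meas: "(\<lambda>\<omega>. ennreal_of_enat (point_count A \<omega>)) \<in> borel_measurable Effros"
    unfolding eq by (intro borel_measurable_suminf_order measurable_count_in_patch B)
  show ?thesis
  proof (rule measurable_enat_ge)
    fix k
    have "{\<omega> \<in> space Effros. enat k \<le> point_count A \<omega>}
        = {\<omega> \<in> space Effros. ennreal_of_enat (enat k) \<le> ennreal_of_enat (point_count A \<omega>)}"
      by (simp only: ennreal_of_enat_le_iff)
    also have "\<dots> \<in> sets Effros" using meas by measurable
    finally show "{\<omega> \<in> space Effros. enat k \<le> point_count A \<omega>} \<in> sets Effros" .
  qed
qed

text \<open>Almost surely the points are distinct and finitely many in each patch. Since the patches are open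
and cover the space, such a set of points is closed, so that the closure of the points carries the same counts as
the sample.\<close>

lemma AE_configuration:
  "AE w in sample_space. configuration w \<in> tame \<and> (\<forall>A. point_count A (configuration w) = ecard (hits A w))"
proof -
  have "AE w in sample_space. finite (hits (patch m) w)" for m
  proof -
    have nn: "Poiss (emeasure M (patch m)) {\<infinity>} = 0"
      using finite_patch[of m] by (auto simp: Poiss_def emeasure_distr vimage_def)
    have "emeasure sample_space ((\<lambda>w. ecard (hits (patch m) w)) -` {\<infinity>} \<inter> space sample_space) = 0"
      using nn unfolding distr_count_hits[OF patch_in_M, symmetric]
      by (subst (asm) emeasure_distr) (auto intro: measurable_count_hits patch_in_M)
    then have "(\<lambda>w. ecard (hits (patch m) w)) -` {\<infinity>} \<inter> space sample_space \<in> null_sets sample_space"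
      using measurable_sets[OF measurable_count_hits[OF patch_in_M]] by auto
    then show ?thesis
      by (rule AE_I') (auto simp: ecard_def)
  qed
  then have "AE w in sample_space. \<forall>m. finite (hits (patch m) w)" by (subst AE_all_countable) auto
  moreover have "AE w in sample_space. inj (snd w)"
    by (rule AE_points_distinct[OF diagonal_measurable]) (rule null_\<nu>)
  ultimately show ?thesis
    using AE_space
  proof eventually_elim
    case (elim w)
    have inj: "inj_on (snd w) S" for S using elim(2) by (rule inj_on_subset) simp
    have sub: "points w \<subseteq> topspace \<tau>"
      using point_in_space[OF elim(3)] by (auto simp: points_def space_M)
    have img: "points w \<inter> A = snd w ` hits A w" for A by (auto simp: points_def hits_def)
    have "closedin \<tau> (points w)"
    proof -
      have "topspace \<tau> - points w = (\<Union>m. patch m - points w \<inter> patch m)"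
        using UN_patch by auto
      moreover have "openin \<tau> (patch m - points w \<inter> patch m)" for m
        using elim(1) img[of "patch m"] sub by (intro openin_diff open_patch closedin_finite) auto
      ultimately have "openin \<tau> (topspace \<tau> - points w)" by auto
      then show ?thesis using sub by (simp add: closedin_def)
    qed
    then have dec: "decode (configuration w) = points w"
      by (simp add: configuration_def decode_code closure_of_eq)
    have "configuration w \<in> tame"
      using measurable_space[OF measurable_configuration elim(3)] elim(1)
      by (simp add: tame_def dec img)
    moreover have "ecard (points w \<inter> A) = ecard (hits A w)" for A
      unfolding img by (rule ecard_image[OF inj])
    ultimately show ?case by (simp add: point_count_def dec)
  qed
qed

lemma AE_tame: "AE \<omega> in config_law. \<omega> \<in> tame"
  unfolding config_law_def using AE_configuration tame_measurable
  by (subst AE_distr_iff[OF measurable_configuration]) (auto simp: sets.sets_into_space[OF tame_measurable] Int_absorb2 tame_def cong: conj_cong)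

lemma distr_point_count:
  assumes A: "A \<in> sets M"
  shows "distr config_law (count_space UNIV) (point_count A) = Poiss (emeasure M A)"
proof -
  have "distr config_law (count_space UNIV) (point_count A)
      = distr sample_space (count_space UNIV) (point_count A \<circ> configuration)"
    unfolding config_law_def by (rule distr_distr[OF measurable_point_count[OF A] measurable_configuration])
  also have "\<dots> = distr sample_space (count_space UNIV) (\<lambda>w. ecard (hits A w))"
  proof (rule distr_cong_AE)
    show "AE w in sample_space. (point_count A \<circ> configuration) w = ecard (hits A w)"
      using AE_configuration by eventually_elim simp
  qed (auto intro: measurable_comp measurable_configuration measurable_point_count A measurable_count_hits)
  finally show ?thesis by (simp add: distr_count_hits[OF A])
qed

lemma measurable_point_count' [measurable]:
  "A \<in> sets M \<Longrightarrow> point_count A \<in> measurable config_law (count_space UNIV)"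
  using measurable_point_count by (simp add: measurable_cong_sets[OF sets_config_law refl])

lemma Poisson_point_process_point_count: "Poisson_point_process M config_law point_count"
  unfolding Poisson_point_process_def
proof (intro conjI ballI impI AE_I2)
  fix A B :: "'a set" and \<omega> assume "A \<inter> B = {}"
  then have "decode \<omega> \<inter> A \<inter> (decode \<omega> \<inter> B) = {}" by auto
  from ecard_Un_disjoint[OF this] show "point_count (A \<union> B) \<omega> = point_count A \<omega> + point_count B \<omega>"
    by (simp add: point_count_def Int_Un_distrib)
qed (auto simp: distr_point_count)

text \<open>On tame configurations, meeting a basic set means having a nonzero count there. The tame set itself need not belong
to the sigma-algebra of the counts, so events are only compared on it.\<close>

lemma generative_point_count: "generative M config_law point_count"
  unfolding generative_def
proof
  fix F assume F: "F \<in> sets config_law"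
  define \<G> where "\<G> = sigma_sets (space config_law) {point_count A -` K \<inter> space config_law | A K. A \<in> sets M}"
  have "F \<in> sigma_sets closed_codes (range (\<lambda>i. {\<omega> \<in> closed_codes. decode \<omega> \<inter> V i \<noteq> {}}))"
    using F by (simp add: sets_Effros)
  then have "\<exists>E\<in>\<G>. F \<inter> tame = E \<inter> tame"
  proof induction
    case (Basic F)
    then obtain i where Fi: "F = {\<omega> \<in> closed_codes. decode \<omega> \<inter> V i \<noteq> {}}" by auto
    have "point_count (V i) -` (- {0}) \<inter> space config_law \<in> \<G>"
      unfolding \<G>_def using open_in_M[OF open_V] by (intro sigma_sets.Basic) blast
    moreover have "F \<inter> tame = (point_count (V i) -` (- {0}) \<inter> space config_law) \<inter> tame"
      by (auto simp: Fi point_count_def)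
    ultimately show ?case by blast
  next
    case Empty
    then show ?case by (auto simp: \<G>_def intro: sigma_sets.Empty)
  next
    case (Compl F)
    then obtain E where "E \<in> \<G>" "F \<inter> tame = E \<inter> tame" by blast
    moreover have "tame \<subseteq> closed_codes" by (auto simp: tame_def)
    ultimately show ?case
      by (intro bexI[of _ "space config_law - E"]) (auto simp: \<G>_def intro: sigma_sets.Compl)
  next
    case (Union F)
    then obtain E where "\<And>i. E i \<in> \<G> \<and> F i \<inter> tame = E i \<inter> tame" by metis
    then show ?case by (intro bexI[of _ "\<Union>i. E i"]) (auto simp: \<G>_def intro: sigma_sets.Union)
  qed
  then obtain E where E: "E \<in> \<G>" and eq: "F \<inter> tame = E \<inter> tame" by blast
  have Es: "E \<in> sets config_law"
    using E unfolding \<G>_def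
    by (rule subsetD[OF sets.sigma_sets_subset, rotated]) (auto intro!: measurable_sets[OF measurable_point_count'] simp del: sets_config_law space_config_law)
  have "AE \<omega> in config_law. \<omega> \<notin> (F - E) \<union> (E - F)"
    using AE_tame by eventually_elim (use eq in auto)
  then have "(F - E) \<union> (E - F) \<in> null_sets config_law"
    using F Es by (subst AE_iff_null_sets) auto
  then show "\<exists>E\<in>sigma_sets (space config_law) {point_count A -` K \<inter> space config_law | A K. A \<in> sets M}.
      emeasure config_law ((F - E) \<union> (E - F)) = 0"
    using E unfolding \<G>_def by (intro bexI[of _ E]) auto
qed

lemma void_probability:
  assumes U: "openin \<tau> U"
  shows "emeasure config_law {\<omega> \<in> closed_codes. decode \<omega> \<inter> U = {}} = Poiss (emeasure M U) {0}"
proof -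
  have vs: "{\<omega> \<in> closed_codes. decode \<omega> \<inter> U = {}} \<in> sets config_law"
  proof -
    have "{\<omega> \<in> closed_codes. decode \<omega> \<inter> U = {}} = space Effros - {\<omega> \<in> closed_codes. decode \<omega> \<inter> U \<noteq> {}}" by auto
    then show ?thesis using sets.compl_sets[OF open_hit_in_Effros[OF U]] by simp
  qed
  have "emeasure config_law {\<omega> \<in> closed_codes. decode \<omega> \<inter> U = {}}
      = emeasure config_law (point_count U -` {0} \<inter> space config_law)"
  proof (rule emeasure_eq_AE[OF _ vs measurable_sets[OF measurable_point_count'[OF open_in_M[OF U]]]])
    show "AE \<omega> in config_law. (\<omega> \<in> {\<omega> \<in> closed_codes. decode \<omega> \<inter> U = {}})
        = (\<omega> \<in> point_count U -` {0} \<inter> space config_law)"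
      using AE_tame by eventually_elim (auto simp: point_count_def)
  qed simp
  also have "\<dots> = emeasure (distr config_law (count_space UNIV) (point_count U)) {0}"
    by (rule emeasure_distr[symmetric]) (auto intro: measurable_point_count' open_in_M U)
  finally show ?thesis by (simp add: distr_point_count[OF open_in_M[OF U]])
qed

text \<open>A single configuration is null: if it is tame and has a point \<open>x\<close>, then it lies in the null event that \<open>x\<close> is
occupied; if it is empty (or not tame, where all counts are 0), it lies in the event that no point occurs
at all, which is null for a base of infinite measure.\<close>

lemma nonatomic_config_law:
  assumes inf: "emeasure M (space M) = \<infinity>"
  shows "nonatomic config_law"
proof (rule nonatomic_if_singletons_null)
  fix \<omega> assume \<omega>: "\<omega> \<in> closed_codes"
  have key: "emeasure config_law {\<omega>} = 0"
    if A: "A \<in> sets M" and neq: "point_count A \<omega> \<in> K" and K: "Poiss (emeasure M A) K = 0" for A K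
  proof -
    have "emeasure config_law {\<omega>} \<le> emeasure config_law (point_count A -` K \<inter> space config_law)"
      using neq \<omega> measurable_sets[OF measurable_point_count'[OF A], of K] by (intro emeasure_mono) auto
    also have "\<dots> = emeasure (distr config_law (count_space UNIV) (point_count A)) K"
      by (rule emeasure_distr[symmetric]) (auto intro: measurable_point_count' A)
    finally show ?thesis using K by (simp add: distr_point_count[OF A])
  qed
  show "emeasure config_law {\<omega>} = 0"
  proof (cases "\<omega> \<in> tame \<and> decode \<omega> \<noteq> {}")
    case True
    then obtain x where x: "x \<in> decode \<omega>" by auto
    then have xs: "x \<in> space M" by (simp add: decode_def space_M)
    show ?thesis
    proof (rule key[of "{x}" "- {0}"])
      show "{x} \<in> sets M" using point_in_borel_of xs by (simp add: sets_M space_M)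
      show "point_count {x} \<omega> \<in> - {0}" using True x by (simp add: point_count_def)
      show "Poiss (emeasure M {x}) (- {0}) = 0" by (simp add: null_point[OF xs] Poiss_def)
    qed
  next
    case False
    show ?thesis
    proof (rule key[OF sets.top, of "{0}"])
      show "point_count (space M) \<omega> \<in> {0}" using False by (auto simp: point_count_def)
      show "Poiss (emeasure M (space M)) {0} = 0" by (simp add: inf Poiss_def)
    qed
  qed
qed simp

end

section \<open>The action on closed sets\<close>

locale configuration_action = random_configuration \<tau> V M c \<nu>
  for \<tau> :: "'a topology" and V :: "nat \<Rightarrow> 'a set" and M :: "'a measure"
    and c :: "nat \<Rightarrow> real" and \<nu> :: "nat \<Rightarrow> 'a measure" +
  fixes G :: "('g, 'b) monoid_scheme" and \<tau>\<^sub>G :: "'g topology" and T :: "'g \<Rightarrow> 'a \<Rightarrow> 'a"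
  assumes Polish_G: "Polish_group G \<tau>\<^sub>G"
    and spatial_T: "spatial_action G \<tau>\<^sub>G M T"
    and continuous_T: "continuous_map (prod_topology \<tau>\<^sub>G \<tau>) \<tau> (\<lambda>(g, x). T g x)"
begin

text \<open>Since every \<open>T g\<close> is a homeomorphism, images of closed sets are closed and the action is defined at
each closed set, not merely at almost every one.\<close>

definition move :: "'g \<Rightarrow> real \<Rightarrow> real" where
  "move g \<omega> = closed_code (T g ` decode \<omega>)"

lemma group_G: "group G" and topspace_G: "topspace \<tau>\<^sub>G = carrier G"
  using Polish_G by (auto simp: Polish_group_def)

lemma inv_closed: "g \<in> carrier G \<Longrightarrow> inv\<^bsub>G\<^esub> g \<in> carrier G"
  using group_G by (rule group.inv_closed)

lemma T_one: "x \<in> space M \<Longrightarrow> T \<one>\<^bsub>G\<^esub> x = x"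
  and T_mult: "g \<in> carrier G \<Longrightarrow> h \<in> carrier G \<Longrightarrow> x \<in> space M \<Longrightarrow> T g (T h x) = T (g \<otimes>\<^bsub>G\<^esub> h) x"
  and T_preserves: "g \<in> carrier G \<Longrightarrow> A \<in> sets M \<Longrightarrow> emeasure M (T g -` A \<inter> space M) = emeasure M A"
  using spatial_T by (auto simp: spatial_action_def Borel_action_def)

lemma T_inv: "g \<in> carrier G \<Longrightarrow> x \<in> space M \<Longrightarrow> T (inv\<^bsub>G\<^esub> g) (T g x) = x"
  and T_inv': "g \<in> carrier G \<Longrightarrow> x \<in> space M \<Longrightarrow> T g (T (inv\<^bsub>G\<^esub> g) x) = x"
  using group_G by (simp_all add: T_mult inv_closed group.l_inv group.r_inv T_one)

lemma continuous_T1: "g \<in> carrier G \<Longrightarrow> continuous_map \<tau> \<tau> (T g)"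
proof -
  assume g: "g \<in> carrier G"
  have "continuous_map \<tau> (prod_topology \<tau>\<^sub>G \<tau>) (\<lambda>x. (g, x))"
    using g by (intro continuous_map_pairedI) (auto simp: topspace_G)
  from continuous_map_compose[OF this continuous_T] show ?thesis by (simp add: comp_def)
qed

lemma T_in_space: "g \<in> carrier G \<Longrightarrow> x \<in> space M \<Longrightarrow> T g x \<in> space M"
  using continuous_T1[of g] by (auto simp: space_M continuous_map_def)

lemma T_vimage_M: "g \<in> carrier G \<Longrightarrow> A \<in> sets M \<Longrightarrow> T g -` A \<inter> space M \<in> sets M"
proof -
  assume g: "g \<in> carrier G" and A: "A \<in> sets M"
  have "T g \<in> measurable M (sigma (topspace \<tau>) {U. openin \<tau> U})"
  proof (rule measurable_measure_of)
    show "T g \<in> space M \<rightarrow> topspace \<tau>" using T_in_space[OF g] by (auto simp: space_M)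
    fix U assume "U \<in> {U. openin \<tau> U}"
    then have "openin \<tau> {x \<in> topspace \<tau>. T g x \<in> U}"
      using openin_continuous_map_preimage[OF continuous_T1[OF g]] by simp
    moreover have "{x \<in> topspace \<tau>. T g x \<in> U} = T g -` U \<inter> space M" by (auto simp: space_M)
    ultimately show "T g -` U \<inter> space M \<in> sets M" using open_in_M by simp
  qed (use openin_subset in auto)
  moreover have "sets (sigma (topspace \<tau>) {U. openin \<tau> U}) = sets M"
    by (simp add: sets_M borel_of_def)
  ultimately show ?thesis using A measurable_sets by blast
qed

lemma open_T_vimage: "g \<in> carrier G \<Longrightarrow> openin \<tau> U \<Longrightarrow> openin \<tau> (T g -` U \<inter> space M)"
  using openin_continuous_map_preimage[OF continuous_T1, of g U]
  by (simp add: space_M vimage_def Int_def conj_commute)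

lemma decode_subset: "decode \<omega> \<subseteq> space M"
  by (auto simp: decode_def space_M)

lemma T_image_eq:
  assumes g: "g \<in> carrier G" and C: "C \<subseteq> space M"
  shows "T g ` C = {x \<in> topspace \<tau>. T (inv\<^bsub>G\<^esub> g) x \<in> C}"
proof (intro Set.set_eqI iffI)
  fix x assume "x \<in> T g ` C"
  then show "x \<in> {x \<in> topspace \<tau>. T (inv\<^bsub>G\<^esub> g) x \<in> C}"
    using C T_in_space[OF g] T_inv[OF g] by (auto simp: subset_iff simp flip: space_M)
next
  fix x assume "x \<in> {x \<in> topspace \<tau>. T (inv\<^bsub>G\<^esub> g) x \<in> C}"
  then show "x \<in> T g ` C" using T_inv'[OF g, of x]
    by (intro image_eqI[of _ _ "T (inv\<^bsub>G\<^esub> g) x"]) (auto simp: space_M)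
qed

lemma closedin_T_image: "g \<in> carrier G \<Longrightarrow> closedin \<tau> C \<Longrightarrow> closedin \<tau> (T g ` C)"
  using closedin_continuous_map_preimage[OF continuous_T1[OF inv_closed], of g C] closedin_subset[of \<tau> C]
  by (simp add: T_image_eq space_M)

lemma decode_move: "g \<in> carrier G \<Longrightarrow> decode (move g \<omega>) = T g ` decode \<omega>"
  unfolding move_def by (intro decode_code closedin_T_image closedin_decode)

lemma move_in_closed_codes: "g \<in> carrier G \<Longrightarrow> move g \<omega> \<in> closed_codes"
  unfolding move_def by (intro code_in_closed_codes closedin_T_image closedin_decode)

lemma decode_move_Int:
  "g \<in> carrier G \<Longrightarrow> decode (move g \<omega>) \<inter> A = T g ` (decode \<omega> \<inter> (T g -` A \<inter> space M))"
  using decode_subset[of \<omega>] by (auto simp: decode_move)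

lemma move_hits_iff:
  "g \<in> carrier G \<Longrightarrow> decode (move g \<omega>) \<inter> A \<noteq> {} \<longleftrightarrow> decode \<omega> \<inter> (T g -` A \<inter> space M) \<noteq> {}"
  by (simp add: decode_move_Int)

lemma inj_on_T: "g \<in> carrier G \<Longrightarrow> inj_on (T g) (space M)"
  by (rule inj_on_inverseI[of _ "T (inv\<^bsub>G\<^esub> g)"]) (rule T_inv)

lemma measurable_move: "g \<in> carrier G \<Longrightarrow> move g \<in> measurable config_law config_law"
proof -
  assume g: "g \<in> carrier G"
  have "move g \<in> measurable config_law Effros"
  proof (rule measurable_into_Effros)
    show "move g \<omega> \<in> closed_codes" for \<omega> by (rule move_in_closed_codes[OF g])
    show "{\<omega> \<in> space config_law. decode (move g \<omega>) \<inter> V i \<noteq> {}} \<in> sets config_law" for i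
      unfolding move_hits_iff[OF g] using open_hit_in_Effros[OF open_T_vimage[OF g open_V]] by simp
  qed
  then show ?thesis by (simp add: measurable_cong_sets[OF refl sets_config_law])
qed

text \<open>Void probabilities suffice: the moved configuration avoids \<open>U\<close> if and only if the configuration
avoids the preimage of \<open>U\<close>, which is open and has the same measure.\<close>

lemma distr_move: 
  assumes g: "g \<in> carrier G"
  shows "distr config_law config_law (move g) = config_law"
proof (rule Effros_measure_eqI)
  show "prob_space (distr config_law config_law (move g))"
    by (rule prob_space.prob_space_distr[OF prob_config_law measurable_move[OF g]])
  show "prob_space config_law" by (rule prob_config_law)
  fix U assume U: "openin \<tau> U"
  have "{\<omega> \<in> closed_codes. decode \<omega> \<inter> U = {}} = space Effros - {\<omega> \<in> closed_codes. decode \<omega> \<inter> U \<noteq> {}}" by auto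
  then have vs: "{\<omega> \<in> closed_codes. decode \<omega> \<inter> U = {}} \<in> sets config_law"
    using sets.compl_sets[OF open_hit_in_Effros[OF U]] by simp
  have "move g -` {\<omega> \<in> closed_codes. decode \<omega> \<inter> U = {}} \<inter> space config_law
      = {\<omega> \<in> closed_codes. decode \<omega> \<inter> (T g -` U \<inter> space M) = {}}"
    using move_hits_iff[OF g, of _ U] move_in_closed_codes[OF g] by auto
  then have "emeasure (distr config_law config_law (move g)) {\<omega> \<in> closed_codes. decode \<omega> \<inter> U = {}}
      = emeasure config_law {\<omega> \<in> closed_codes. decode \<omega> \<inter> (T g -` U \<inter> space M) = {}}"
    by (simp only: emeasure_distr[OF measurable_move[OF g] vs])
  also have "\<dots> = Poiss (emeasure M (T g -` U \<inter> space M)) {0}"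
    by (rule void_probability[OF open_T_vimage[OF g U]])
  also have "\<dots> = emeasure config_law {\<omega> \<in> closed_codes. decode \<omega> \<inter> U = {}}"
    by (simp add: T_preserves[OF g open_in_M[OF U]] void_probability[OF U])
  finally show "emeasure (distr config_law config_law (move g)) {\<omega> \<in> closed_codes. decode \<omega> \<inter> U = {}}
      = emeasure config_law {\<omega> \<in> closed_codes. decode \<omega> \<inter> U = {}}" .
qed auto

text \<open>By joint continuity, the pairs \<open>(g, x)\<close> with \<open>T g x\<close> in a basic set form an open set, hence a
countable union of boxes of basic sets. The set of pairs of a group element and a closed set whose
image meets the basic set is the union of the corresponding boxes.\<close>

lemma jointly_measurable_move:
  "(\<lambda>(g, \<omega>). move g \<omega>) \<in> measurable (borel_of \<tau>\<^sub>G \<Otimes>\<^sub>M config_law) config_law"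
proof -
  have sG: "space (borel_of \<tau>\<^sub>G) = carrier G"
    by (simp add: space_borel_of topspace_G)
  have "second_countable \<tau>\<^sub>G" using Polish_G by (simp add: Polish_group_def Polish_topology_def)
  then obtain \<B> where \<B>: "countable \<B>" "\<And>W. W \<in> \<B> \<Longrightarrow> openin \<tau>\<^sub>G W"
    "\<And>U g. openin \<tau>\<^sub>G U \<Longrightarrow> g \<in> U \<Longrightarrow> \<exists>W\<in>\<B>. g \<in> W \<and> W \<subseteq> U"
    unfolding second_countable_def by metis
  have "(\<lambda>(g, \<omega>). move g \<omega>) \<in> measurable (borel_of \<tau>\<^sub>G \<Otimes>\<^sub>M config_law) Effros"
  proof (rule measurable_into_Effros)
    fix p assume "p \<in> space (borel_of \<tau>\<^sub>G \<Otimes>\<^sub>M config_law)"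
    then show "(case p of (g, \<omega>) \<Rightarrow> move g \<omega>) \<in> closed_codes"
      by (auto simp: space_pair_measure sG intro: move_in_closed_codes)
  next
    fix i
    define J where "J = {q \<in> \<B> \<times> UNIV. \<forall>g\<in>fst q. \<forall>x\<in>V (snd q). T g x \<in> V i}"
    have iff: "decode (move g \<omega>) \<inter> V i \<noteq> {} \<longleftrightarrow> (\<exists>q\<in>J. g \<in> fst q \<and> decode \<omega> \<inter> V (snd q) \<noteq> {})"
      if g: "g \<in> carrier G" for g \<omega>
    proof
      assume "decode (move g \<omega>) \<inter> V i \<noteq> {}"
      then obtain x where x: "x \<in> decode \<omega>" "T g x \<in> V i" by (auto simp: decode_move[OF g])
      define R where "R = {p \<in> topspace (prod_topology \<tau>\<^sub>G \<tau>). (\<lambda>(g, x). T g x) p \<in> V i}"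
      have "openin (prod_topology \<tau>\<^sub>G \<tau>) R"
        unfolding R_def by (rule openin_continuous_map_preimage[OF continuous_T open_V])
      moreover have "(g, x) \<in> R"
        using x g decode_subset[of \<omega>] by (auto simp: R_def topspace_G space_M)
      ultimately obtain A B where AB: "openin \<tau>\<^sub>G A" "openin \<tau> B" "g \<in> A" "x \<in> B" "A \<times> B \<subseteq> R"
        unfolding openin_prod_topology_alt by metis
      obtain W where W: "W \<in> \<B>" "g \<in> W" "W \<subseteq> A" using \<B>(3)[OF AB(1,3)] by blast
      obtain j where j: "x \<in> V j" "V j \<subseteq> B" using base_V[OF AB(2,4)] by blast
      have "T h y \<in> V i" if "h \<in> W" "y \<in> V j" for h y
      proof -
        have "(h, y) \<in> R" using that W j AB(5) by blast
        then show ?thesis by (simp add: R_def)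
      qed
      then have "(W, j) \<in> J" using W(1) by (simp add: J_def)
      then show "\<exists>q\<in>J. g \<in> fst q \<and> decode \<omega> \<inter> V (snd q) \<noteq> {}"
        using W(2) x(1) j(1) by (intro bexI[of _ "(W, j)"]) auto
    next
      assume "\<exists>q\<in>J. g \<in> fst q \<and> decode \<omega> \<inter> V (snd q) \<noteq> {}"
      then show "decode (move g \<omega>) \<inter> V i \<noteq> {}"
        by (auto simp: J_def decode_move[OF g])
    qed
    have "{p \<in> space (borel_of \<tau>\<^sub>G \<Otimes>\<^sub>M config_law). decode (case p of (g, \<omega>) \<Rightarrow> move g \<omega>) \<inter> V i \<noteq> {}}
        = (\<Union>q\<in>J. fst q \<times> {\<omega> \<in> closed_codes. decode \<omega> \<inter> V (snd q) \<noteq> {}})" (is "?L = ?R")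
    proof (intro Set.set_eqI iffI)
      fix p assume "p \<in> ?L"
      then show "p \<in> ?R" using iff by (cases p) (force simp: space_pair_measure sG)
    next
      fix p assume "p \<in> ?R"
      then obtain q where qJ: "q \<in> J"
        and "p \<in> fst q \<times> {\<omega> \<in> closed_codes. decode \<omega> \<inter> V (snd q) \<noteq> {}}" by (rule UN_E)
      then have q: "fst p \<in> fst q" "snd p \<in> closed_codes" "decode (snd p) \<inter> V (snd q) \<noteq> {}"
        by (simp_all add: mem_Times_iff)
      have g: "fst p \<in> carrier G"
        using qJ q openin_subset[OF \<B>(2), of "fst q"] by (auto simp: J_def topspace_G)
      have "decode (move (fst p) (snd p)) \<inter> V i \<noteq> {}" unfolding iff[OF g] using qJ q by blast
      then show "p \<in> ?L" using g q by (cases p) (auto simp: space_pair_measure sG)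
    qed
    also have "\<dots> \<in> sets (borel_of \<tau>\<^sub>G \<Otimes>\<^sub>M config_law)"
    proof (rule sets.countable_UN'')
      show "countable J" by (rule countable_subset[of _ "\<B> \<times> UNIV"]) (auto simp: J_def \<B>(1))
      show "fst q \<times> {\<omega> \<in> closed_codes. decode \<omega> \<inter> V (snd q) \<noteq> {}} \<in> sets (borel_of \<tau>\<^sub>G \<Otimes>\<^sub>M config_law)"
        if "q \<in> J" for q
        using that base_hit_in_Effros by (intro pair_measureI) (auto simp: J_def intro!: open_in_borel_of \<B>(2))
    qed
    finally show "{p \<in> space (borel_of \<tau>\<^sub>G \<Otimes>\<^sub>M config_law).
        decode (case p of (g, \<omega>) \<Rightarrow> move g \<omega>) \<inter> V i \<noteq> {}} \<in> sets (borel_of \<tau>\<^sub>G \<Otimes>\<^sub>M config_law)" .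
  qed
  then show ?thesis by (simp add: measurable_cong_sets[OF refl sets_config_law])
qed

lemma spatial_action_move: "spatial_action G \<tau>\<^sub>G config_law move"
  unfolding spatial_action_def Borel_action_def
proof (intro conjI ballI)
  show "(\<lambda>(g, \<omega>). move g \<omega>) \<in> borel_of \<tau>\<^sub>G \<Otimes>\<^sub>M config_law \<rightarrow>\<^sub>M config_law"
    by (rule jointly_measurable_move)
next
  fix \<omega> assume \<omega>: "\<omega> \<in> space config_law"
  have "T \<one>\<^bsub>G\<^esub> ` decode \<omega> = (\<lambda>x. x) ` decode \<omega>"
    by (rule image_cong) (use T_one decode_subset in auto)
  then show "move \<one>\<^bsub>G\<^esub> \<omega> = \<omega>" using code_decode \<omega> by (simp add: move_def)
next
  fix g h \<omega> assume gh: "g \<in> carrier G" "h \<in> carrier G"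
  have "T g ` T h ` decode \<omega> = T (g \<otimes>\<^bsub>G\<^esub> h) ` decode \<omega>"
    unfolding image_image by (rule image_cong) (use T_mult[OF gh] decode_subset in auto)
  then show "move g (move h \<omega>) = move (g \<otimes>\<^bsub>G\<^esub> h) \<omega>"
    unfolding move_def[of g] move_def[of "g \<otimes>\<^bsub>G\<^esub> h"] decode_move[OF gh(2)] by simp
next
  fix g A assume g: "g \<in> carrier G" and A: "A \<in> sets config_law"
  show "emeasure config_law (move g -` A \<inter> space config_law) = emeasure config_law A"
    using emeasure_distr[OF measurable_move[OF g] A] by (simp add: distr_move[OF g])
qed

lemma base_action_move: "base_action G M T config_law point_count move"
  unfolding base_action_def
proof (intro ballI)
  fix g A assume g: "g \<in> carrier G" and A: "A \<in> sets M"
  have "AE \<omega> in distr config_law config_law (move g). \<omega> \<in> tame"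
    unfolding distr_move[OF g] by (rule AE_tame)
  then have "AE \<omega> in config_law. move g \<omega> \<in> tame"
    by (rule AE_distrD[OF measurable_move[OF g]])
  with AE_tame show "AE \<omega> in config_law. point_count A (move g \<omega>) = point_count (T g -` A \<inter> space M) \<omega>"
  proof eventually_elim
    case (elim \<omega>)
    have "inj_on (T g) (decode \<omega> \<inter> (T g -` A \<inter> space M))"
      by (rule inj_on_subset[OF inj_on_T[OF g]]) auto
    then show ?case using elim by (simp add: point_count_def decode_move_Int[OF g] ecard_image)
  qed
qed

text \<open>Up to null sets, moving by \<open>inv g\<close> turns the count of \<open>A\<close> into the count of the preimage of \<open>A\<close>,
which has the same measure. So the Koopman operator maps linear combinations of counts to such
combinations, and being isometric it respects approximation by them.\<close>

lemma Koopman_preserves_H: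
  assumes g: "g \<in> carrier G"
  shows "Koopman G move g ` Poisson_H M config_law point_count \<subseteq> Poisson_H M config_law point_count"
proof
  define h where "h = inv\<^bsub>G\<^esub> g"
  have h: "h \<in> carrier G" unfolding h_def by (rule inv_closed[OF g])
  note mh = measurable_move[OF h]
  fix f' assume "f' \<in> Koopman G move g ` Poisson_H M config_law point_count"
  then obtain f where f: "f \<in> Poisson_H M config_law point_count" and f': "f' = f \<circ> move h"
    by (auto simp: Koopman_def h_def)
  have fm: "f \<in> borel_measurable config_law" and fi: "integrable config_law (\<lambda>\<omega>. (f \<omega>)\<^sup>2)"
    using f by (auto simp: Poisson_H_def square_integrable_def)
  have span_m: "u \<in> borel_measurable config_law" if u: "u \<in> Poisson_span M point_count" for u
  proof -
    obtain \<A> a where ua: "u = (\<lambda>\<omega>. \<Sum>A\<in>\<A>. a A * real_count point_count A \<omega>)"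
      and \<A>: "\<A> \<subseteq> {A \<in> sets M. emeasure M A < \<infinity>}"
      using u by (auto simp: Poisson_span_def)
    have "real_count point_count A \<in> borel_measurable config_law" if "A \<in> \<A>" for A
      unfolding real_count_def using that \<A>
      by (intro measurable_compose[OF measurable_point_count']) auto
    then show ?thesis unfolding ua by (intro borel_measurable_sum borel_measurable_times) auto
  qed
  have "square_integrable config_law f'"
    unfolding square_integrable_def
  proof
    show "f' \<in> borel_measurable config_law" unfolding f' by (rule measurable_comp[OF mh fm])
    have "integrable (distr config_law config_law (move h)) (\<lambda>\<omega>. (f \<omega>)\<^sup>2)"
      using fi by (simp add: distr_move[OF h])
    then show "integrable config_law (\<lambda>\<omega>. (f' \<omega>)\<^sup>2)"
      using integrable_distr[OF mh] by (simp add: f')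
  qed
  moreover have "\<exists>u'\<in>Poisson_span M point_count. sqrt (\<integral>\<omega>. (f' \<omega> - u' \<omega>)\<^sup>2 \<partial>config_law) < \<epsilon>"
    if \<epsilon>: "\<epsilon> > 0" for \<epsilon>
  proof -
    obtain u where u: "u \<in> Poisson_span M point_count"
      and le: "sqrt (\<integral>\<omega>. (f \<omega> - u \<omega>)\<^sup>2 \<partial>config_law) < \<epsilon>"
      using f \<epsilon> by (auto simp: Poisson_H_def)
    then obtain \<A> a where ua: "u = (\<lambda>\<omega>. \<Sum>A\<in>\<A>. a A * real_count point_count A \<omega>)"
      and \<A>: "finite \<A>" "\<A> \<subseteq> {A \<in> sets M. emeasure M A < \<infinity>}"
      by (auto simp: Poisson_span_def)
    (* The approximant u' has the sets \<Phi> A in place of A. A combination is indexed by its sets,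
       so the coefficients have to be moved along the inverse \<Psi> of \<Phi>. *)
    define \<Phi> where "\<Phi> A = T h -` A \<inter> space M" for A
    define \<Psi> where "\<Psi> B = T g -` B \<inter> space M" for B
    have hg: "T h (T g x) = x" if "x \<in> space M" for x using T_inv[OF g that] by (simp add: h_def)
    have \<Psi>\<Phi>: "\<Psi> (\<Phi> A) = A" if "A \<in> \<A>" for A
    proof -
      have "A \<subseteq> space M" using that \<A>(2) sets.sets_into_space by blast
      moreover have "\<Psi> (\<Phi> A) = {x \<in> space M. T h (T g x) \<in> A}"
        using T_in_space[OF g] by (auto simp: \<Psi>_def \<Phi>_def)
      moreover have "\<dots> = {x \<in> space M. x \<in> A}" using hg by (intro Collect_cong) auto
      ultimately show ?thesis by auto
    qed
    have inj: "inj_on \<Phi> \<A>" by (rule inj_on_inverseI[of _ \<Psi>]) (rule \<Psi>\<Phi>)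
    define u' where "u' = (\<lambda>\<omega>. \<Sum>B\<in>\<Phi> ` \<A>. a (\<Psi> B) * real_count point_count B \<omega>)"
    have "finite (\<Phi> ` \<A>)" using \<A>(1) by (rule finite_imageI)
    moreover have "\<Phi> ` \<A> \<subseteq> {A \<in> sets M. emeasure M A < \<infinity>}"
      using \<A>(2) T_vimage_M[OF h] T_preserves[OF h] by (auto simp: \<Phi>_def)
    ultimately have u': "u' \<in> Poisson_span M point_count"
      unfolding Poisson_span_def mem_Collect_eq u'_def
      by (intro exI[of _ "\<Phi> ` \<A>"] exI[of _ "\<lambda>B. a (\<Psi> B)"] conjI refl)
    have u'_eq: "u' \<omega> = (\<Sum>A\<in>\<A>. a A * real_count point_count (\<Phi> A) \<omega>)" for \<omega>
      unfolding u'_def by (simp add: sum.reindex[OF inj] \<Psi>\<Phi>)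
    have "AE \<omega> in config_law. \<forall>A\<in>\<A>. point_count A (move h \<omega>) = point_count (\<Phi> A) \<omega>"
      using \<A> base_action_move h unfolding base_action_def \<Phi>_def
      by (intro AE_finite_allI) auto
    then have ae: "AE \<omega> in config_law. u (move h \<omega>) = u' \<omega>"
      by eventually_elim (simp add: ua u'_eq real_count_def)
    have "(\<integral>\<omega>. (f \<omega> - u \<omega>)\<^sup>2 \<partial>config_law) = (\<integral>\<omega>. (f \<omega> - u \<omega>)\<^sup>2 \<partial>distr config_law config_law (move h))"
      by (simp add: distr_move[OF h])
    also have "\<dots> = (\<integral>\<omega>. (f (move h \<omega>) - u (move h \<omega>))\<^sup>2 \<partial>config_law)"
      using fm span_m[OF u] by (intro integral_distr mh) measurable
    also have "\<dots> = (\<integral>\<omega>. (f' \<omega> - u' \<omega>)\<^sup>2 \<partial>config_law)"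
    proof (rule integral_cong_AE)
      show "(\<lambda>\<omega>. (f (move h \<omega>) - u (move h \<omega>))\<^sup>2) \<in> borel_measurable config_law"
        using measurable_compose[OF mh fm] measurable_compose[OF mh span_m[OF u]] by measurable
      show "(\<lambda>\<omega>. (f' \<omega> - u' \<omega>)\<^sup>2) \<in> borel_measurable config_law"
        using measurable_comp[OF mh fm] span_m[OF u'] unfolding f' by measurable
      show "AE \<omega> in config_law. (f (move h \<omega>) - u (move h \<omega>))\<^sup>2 = (f' \<omega> - u' \<omega>)\<^sup>2"
        using ae by eventually_elim (simp add: f')
    qed
    finally show ?thesis using le u' by auto
  qed
  ultimately show "f' \<in> Poisson_H M config_law point_count"
    by (simp add: Poisson_H_def)
qed

end

section \<open>Existence of the spatial Poissonian action\<close>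

lemma nonatomic_null_point:
  assumes "nonatomic M" and x: "{x} \<in> sets M"
  shows "emeasure M {x} = 0"
proof (rule ccontr)
  assume "emeasure M {x} \<noteq> 0"
  then have "is_atom M {x}"
    using x by (auto simp: is_atom_def zero_less_iff_neq_zero subset_singleton_iff)
  then show False using assms(1) by (auto simp: nonatomic_def)
qed

theorem theorem4:
  fixes G :: "('g, 'b) monoid_scheme" and \<tau>\<^sub>G :: "'g topology"
    and M :: "'a measure" and T :: "'g \<Rightarrow> 'a \<Rightarrow> 'a"
  assumes "Polish_group G \<tau>\<^sub>G"
    and "locally_finite_Polish_action G \<tau>\<^sub>G M T"
  shows "\<exists>(\<Omega> :: real measure) (P :: 'a set \<Rightarrow> real \<Rightarrow> enat) (S :: 'g \<Rightarrow> real \<Rightarrow> real).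
           standard_Borel_space \<Omega> \<and> prob_space \<Omega> \<and>
           (emeasure M (space M) = \<infinity> \<longrightarrow> standard_probability_space \<Omega>) \<and>
           Poisson_point_process M \<Omega> P \<and> generative M \<Omega> P \<and>
           spatial_Poissonian_action G \<tau>\<^sub>G M \<Omega> P S \<and>
           base_action G M T \<Omega> P S"
proof -
  from assms(2) obtain \<tau> where std: "standard_measure_space M" and sp: "spatial_action G \<tau>\<^sub>G M T"
    and gen: "generating_Polish_topology M \<tau>"
    and cont: "continuous_map (prod_topology \<tau>\<^sub>G \<tau>) \<tau> (\<lambda>(g, x). T g x)"
    and lf: "locally_finite_measure_on \<tau> M"
    by (auto simp: locally_finite_Polish_action_def)
  from gen have "Polish_topology \<tau>" and space: "topspace \<tau> = space M" and sets: "sets M = sets (borel_of \<tau>)"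
    by (auto simp: generating_Polish_topology_def)
  then obtain V where V: "Polish_base \<tau> V" using Polish_base_exists by blast
  interpret Polish_base \<tau> V by fact
  have point: "{x} \<in> sets M" if "x \<in> space M" for x
    using point_in_borel_of that by (simp add: sets space)
  have null: "emeasure M {x} = 0" if "x \<in> space M" for x
    using std point[OF that] by (intro nonatomic_null_point) (auto simp: standard_measure_space_def)
  have sf: "sigma_finite_measure M" and pos: "emeasure M (space M) \<noteq> 0"
    using std prob_space.emeasure_space_1[of M] prob_space_imp_sigma_finite[of M]
    by (auto simp: standard_measure_space_def)
  obtain c \<nu> where ps: "poisson_sampling M c \<nu>"
    and null\<nu>: "\<And>n x. x \<in> space M \<Longrightarrow> emeasure (\<nu> n) {x} = 0"
    using poisson_sampling_exists[OF sf pos null] by blast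
  interpret configuration_action \<tau> V M c \<nu> G \<tau>\<^sub>G T
    by (intro configuration_action.intro random_configuration.intro V ps
        random_configuration_axioms.intro configuration_action_axioms.intro assms(1) sp cont sets lf null null\<nu>)
  have Borel: "standard_Borel_space config_law" by (rule standard_Borel_Effros) simp
  show ?thesis
  proof (intro exI conjI impI)
    show "standard_Borel_space config_law" "prob_space config_law"
      by (rule Borel prob_config_law)+
    show "standard_probability_space config_law" if "emeasure M (space M) = \<infinity>"
      using Borel prob_config_law nonatomic_config_law[OF that]
      by (simp add: standard_probability_space_def standard_measure_space_def)
    show "Poisson_point_process M config_law point_count" by (rule Poisson_point_process_point_count)
    show "generative M config_law point_count" by (rule generative_point_count)
    show "spatial_Poissonian_action G \<tau>\<^sub>G M config_law point_count move"
      unfolding spatial_Poissonian_action_def using spatial_action_move Koopman_preserves_H by blast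
    show "base_action G M T config_law point_count move" by (rule base_action_move)
  qed
qed

end
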